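(* Let $\mathcal G$ be an amenable groupoid and $V$ a Banach $\mathcal G$-module with topological dual $V'$. Then $H_b^n(\mathcal G;V')=0$ for all integers $n\ge 1$.
   Context: **Groupoids and modules.** A groupoid $\mathcal G$ is a small category in which all morphisms are invertible; $g\in\mathcal G$ means that $g$ is a morphism, with source $s(g)$ and target $t(g)$; $gh=g\circ h$ is defined if $s(g)=t(h)$. A normed $\mathcal G$-module $V=(V_e)_{e\in\mathrm{ob}\,\mathcal G}$ is a family of normed real vector spaces with linear isometries $V_{s(g)}\to V_{t(g)}$, $v\mapsto g\cdot v$ ($g\in\mathcal G$), satisfying $g\cdot(h\cdot v)=(gh)\cdot v$ and $\mathrm{id}_e\cdot v=v$; it is a Banach $\mathcal G$-module if each $V_e$ is complete. A $\mathcal G$-map $f\colon V\to W$ is an equivariant family of bounded linear maps $f_e\colon V_e\to W_e$ with $\|f\|_\infty=\sup_e\|f_e\|<\infty$. $\mathbb R_{\mathcal G}$ is the family $(\mathbb R)_{e}$ with trivial action. $B(V,W)=(B(V_e,W_e))_e$ (bounded linear maps, operator norm) with action $(g\cdot f)(v)=g\cdot f(g^{-1}\cdot v)$; $V'=B(V,\mathbb R_{\mathcal G})$. The invariants are $V^{\mathcal G}=\{v\in\prod_e V_e\mid g\cdot v_{s(g)}=v_{t(g)}\ \forall g,\ \sup_e\|v_e\|<\infty\}$ with the sup-norm, and $B_{\mathcal G}(V,W)=B(V,W)^{\mathcal G}$. **Bounded cohomology.** $C_n(\mathcal G)_e$ is the real vector space with basis $P_n(\mathcal G)_e=\{(g_0,\dots,g_n)\in\mathcal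 G^{n+1}\mid s(g_i)=t(g_{i+1})\ (0\le i<n),\ t(g_0)=e\}$, with the $\ell^1$-norm, action $g\cdot(g_0,\dots,g_n)=(gg_0,g_1,\dots,g_n)$ and boundary $\partial_n(g_0,\dots,g_n)=\sum_{i=0}^{n-1}(-1)^i(g_0,\dots,g_ig_{i+1},\dots,g_n)+(-1)^n(g_0,\dots,g_{n-1})$. $H_b^\ast(\mathcal G;V)$ is the cohomology of $B_{\mathcal G}(C_\ast(\mathcal G),V)$. **Amenability.** Let $\ell^\infty(\mathcal G,\mathbb R_{\mathcal G})$ be the normed $\mathcal G$-module with $\ell^\infty(\mathcal G,\mathbb R_{\mathcal G})_e=\ell^\infty(t^{-1}(e),\mathbb R)$ (sup-norm; $t^{-1}(e)$ is the set of morphisms ending in $e$) and action $(g\cdot\varphi)(h)=\varphi(g^{-1}h)$. $\mathcal G$ is amenable if there is a $\mathcal G$-map $m\colon\ell^\infty(\mathcal G,\mathbb R_{\mathcal G})\to\mathbb R_{\mathcal G}$ with $\|m\|_\infty=1$ that maps each constant function to its value. *)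

theory Defs
  imports
    "HOL-Analysis.Abstract_Metric_Spaces"
    "HOL-Algebra.Algebra"
    "HOL-Algebra.Algebraic_Closure_Type"
begin

section \<open>Groupoids\<close>

record ('o, 'g) groupoid =
  ob :: "'o set"
  mor :: "'g set"
  src :: "'g \<Rightarrow> 'o"
  tgt :: "'g \<Rightarrow> 'o"
  cmp :: "'g \<Rightarrow> 'g \<Rightarrow> 'g"
  ident :: "'o \<Rightarrow> 'g"

text \<open>\<open>cmp G g h\<close> is \<open>g \<circ> h\<close>, meaningful if \<open>src G g = tgt G h\<close>.\<close>

locale groupoid =
  fixes G :: "('o, 'g) groupoid"
  assumes src_ob: "g \<in> mor G \<Longrightarrow> src G g \<in> ob G"
    and tgt_ob: "g \<in> mor G \<Longrightarrow> tgt G g \<in> ob G"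
    and cmp_mor: "\<lbrakk>g \<in> mor G; h \<in> mor G; src G g = tgt G h\<rbrakk> \<Longrightarrow> cmp G g h \<in> mor G"
    and src_cmp: "\<lbrakk>g \<in> mor G; h \<in> mor G; src G g = tgt G h\<rbrakk> \<Longrightarrow> src G (cmp G g h) = src G h"
    and tgt_cmp: "\<lbrakk>g \<in> mor G; h \<in> mor G; src G g = tgt G h\<rbrakk> \<Longrightarrow> tgt G (cmp G g h) = tgt G g"
    and cmp_assoc: "\<lbrakk>g \<in> mor G; h \<in> mor G; k \<in> mor G; src G g = tgt G h; src G h = tgt G k\<rbrakk>
      \<Longrightarrow> cmp G (cmp G g h) k = cmp G g (cmp G h k)"
    and ident_mor: "e \<in> ob G \<Longrightarrow> ident G e \<in> mor G"
    and src_ident: "e \<in> ob G \<Longrightarrow> src G (ident G e) = e"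
    and tgt_ident: "e \<in> ob G \<Longrightarrow> tgt G (ident G e) = e"
    and ident_left: "g \<in> mor G \<Longrightarrow> cmp G (ident G (tgt G g)) g = g"
    and ident_right: "g \<in> mor G \<Longrightarrow> cmp G g (ident G (src G g)) = g"
    and invertible: "g \<in> mor G \<Longrightarrow> \<exists>h \<in> mor G. src G h = tgt G g \<and> tgt G h = src G g \<and>
      cmp G g h = ident G (tgt G g) \<and> cmp G h g = ident G (src G g)"

definition ginv :: "('o, 'g) groupoid \<Rightarrow> 'g \<Rightarrow> 'g" where
  "ginv G g = (THE h. h \<in> mor G \<and> src G h = tgt G g \<and> tgt G h = src G g \<and>
      cmp G g h = ident G (tgt G g) \<and> cmp G h g = ident G (src G g))"

section \<open>Normed real vector spaces with explicit carrier\<close>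

text \<open>
  The spaces of a \<open>G\<close>-module vary with the object, so they are given by carrier sets, as modules
  over the field of reals in the sense of HOL-Algebra. The record type \<open>module\<close> inherits the
  multiplicative fields \<open>mult\<close> and \<open>one\<close> of \<open>ring\<close>; the locale \<open>module\<close>
  does not constrain them and they are never used here.
\<close>

record 'v nspace = "(real, 'v) module" +
  nrm :: "'v \<Rightarrow> real"

definition mk_nspace ::
  "'v set \<Rightarrow> 'v \<Rightarrow> ('v \<Rightarrow> 'v \<Rightarrow> 'v) \<Rightarrow> (real \<Rightarrow> 'v \<Rightarrow> 'v) \<Rightarrow> ('v \<Rightarrow> real) \<Rightarrow> 'v nspace" where
  "mk_nspace C z a s N = \<lparr>carrier = C, monoid.mult = undefined, one = undefined,
     ring.zero = z, add = a, module.smult = s, nrm = N\<rparr>"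

locale normed_space_on = module "ring_of_type_algebra :: real ring" V
  for V :: "'v nspace" (structure) +
  assumes nrm_eq_0: "x \<in> carrier V \<Longrightarrow> nrm V x = 0 \<longleftrightarrow> x = \<zero>\<^bsub>V\<^esub>"
    and nrm_nonneg: "x \<in> carrier V \<Longrightarrow> 0 \<le> nrm V x"
    and nrm_triangle: "\<lbrakk>x \<in> carrier V; y \<in> carrier V\<rbrakk> \<Longrightarrow> nrm V (x \<oplus>\<^bsub>V\<^esub> y) \<le> nrm V x + nrm V y"
    and nrm_smult: "x \<in> carrier V \<Longrightarrow> nrm V (a \<odot>\<^bsub>V\<^esub> x) = \<bar>a\<bar> * nrm V x"

locale banach_space_on = normed_space_on +
  assumes complete: "Metric_space.mcomplete (carrier V) (\<lambda>x y. nrm V (x \<ominus>\<^bsub>V\<^esub> y))"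

text \<open>Supremum of a set of nonnegative reals, with value 0 on the empty set.\<close>

definition sup0 :: "real set \<Rightarrow> real" where
  "sup0 A = Sup (insert 0 A)"

definition real_space :: "real nspace" where
  "real_space = mk_nspace UNIV 0 (+) (*) abs"

definition linf_space :: "'a set \<Rightarrow> ('a \<Rightarrow> real) nspace" where
  "linf_space S = mk_nspace
     {\<phi> \<in> extensional S. bounded (\<phi> ` S)}
     (\<lambda>x\<in>S. 0) (\<lambda>\<phi> \<psi>. \<lambda>x\<in>S. \<phi> x + \<psi> x) (\<lambda>a \<phi>. \<lambda>x\<in>S. a * \<phi> x)
     (\<lambda>\<phi>. sup0 ((\<lambda>x. \<bar>\<phi> x\<bar>) ` S))"

text \<open>The real vector space with basis \<open>S\<close>, as finitely supported functions, with the
  \<open>\<ell>\<^sup>1\<close>-norm. The basis vector of \<open>x\<close> is \<open>indicat_real {x}\<close>.\<close>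

definition l1_free_space :: "'a set \<Rightarrow> ('a \<Rightarrow> real) nspace" where
  "l1_free_space S = mk_nspace
     {c. finite {x. c x \<noteq> 0} \<and> {x. c x \<noteq> 0} \<subseteq> S}
     (\<lambda>x. 0) (\<lambda>c d x. c x + d x) (\<lambda>a c x. a * c x)
     (\<lambda>c. \<Sum>x | c x \<noteq> 0. \<bar>c x\<bar>)"

definition lin_ext :: "('a \<Rightarrow> 'b \<Rightarrow> real) \<Rightarrow> ('a \<Rightarrow> real) \<Rightarrow> 'b \<Rightarrow> real" where
  "lin_ext \<phi> c = (\<lambda>y. \<Sum>x | c x \<noteq> 0. c x * \<phi> x y)"

definition linear_on :: "'v nspace \<Rightarrow> 'w nspace \<Rightarrow> ('v \<Rightarrow> 'w) \<Rightarrow> bool" where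
  "linear_on V W f \<longleftrightarrow> f \<in> carrier V \<rightarrow> carrier W \<and>
     (\<forall>x \<in> carrier V. \<forall>y \<in> carrier V. f (x \<oplus>\<^bsub>V\<^esub> y) = f x \<oplus>\<^bsub>W\<^esub> f y) \<and>
     (\<forall>a. \<forall>x \<in> carrier V. f (a \<odot>\<^bsub>V\<^esub> x) = a \<odot>\<^bsub>W\<^esub> f x)"

definition bounded_linear_on :: "'v nspace \<Rightarrow> 'w nspace \<Rightarrow> ('v \<Rightarrow> 'w) \<Rightarrow> bool" where
  "bounded_linear_on V W f \<longleftrightarrow> linear_on V W f \<and>
     (\<exists>K. \<forall>x \<in> carrier V. nrm W (f x) \<le> K * nrm V x)"

text \<open>The quotient is 0 at \<open>x = 0\<close>, as in \<open>onorm\<close>.\<close>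

definition op_nrm :: "'v nspace \<Rightarrow> 'w nspace \<Rightarrow> ('v \<Rightarrow> 'w) \<Rightarrow> real" where
  "op_nrm V W f = sup0 ((\<lambda>x. nrm W (f x) / nrm V x) ` carrier V)"

definition op_space :: "'v nspace \<Rightarrow> 'w nspace \<Rightarrow> ('v \<Rightarrow> 'w) nspace" where
  "op_space V W = mk_nspace
     {f \<in> extensional (carrier V). bounded_linear_on V W f}
     (\<lambda>x\<in>carrier V. \<zero>\<^bsub>W\<^esub>) (\<lambda>f g. \<lambda>x\<in>carrier V. f x \<oplus>\<^bsub>W\<^esub> g x)
     (\<lambda>a f. \<lambda>x\<in>carrier V. a \<odot>\<^bsub>W\<^esub> f x) (op_nrm V W)"

section \<open>Modules over a groupoid\<close>

record ('o, 'g, 'v) gmodule =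
  sp :: "'o \<Rightarrow> 'v nspace"
  act :: "'g \<Rightarrow> 'v \<Rightarrow> 'v"

locale normed_gmodule = groupoid G for G :: "('o, 'g) groupoid" +
  fixes V :: "('o, 'g, 'v) gmodule"
  assumes normed: "e \<in> ob G \<Longrightarrow> normed_space_on (sp V e)"
    and act_linear: "g \<in> mor G \<Longrightarrow> linear_on (sp V (src G g)) (sp V (tgt G g)) (act V g)"
    and act_isometry: "\<lbrakk>g \<in> mor G; v \<in> carrier (sp V (src G g))\<rbrakk>
      \<Longrightarrow> nrm (sp V (tgt G g)) (act V g v) = nrm (sp V (src G g)) v"
    and act_cmp: "\<lbrakk>g \<in> mor G; h \<in> mor G; src G g = tgt G h; v \<in> carrier (sp V (src G h))\<rbrakk>
      \<Longrightarrow> act V g (act V h v) = act V (cmp G g h) v"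
    and act_ident: "\<lbrakk>e \<in> ob G; v \<in> carrier (sp V e)\<rbrakk> \<Longrightarrow> act V (ident G e) v = v"

locale banach_gmodule = normed_gmodule +
  assumes banach: "e \<in> ob G \<Longrightarrow> banach_space_on (sp V e)"

definition triv_gmodule :: "('o, 'g, real) gmodule" where
  "triv_gmodule = \<lparr>sp = (\<lambda>e. real_space), act = (\<lambda>g v. v)\<rparr>"

definition hom_gmodule ::
  "('o, 'g) groupoid \<Rightarrow> ('o, 'g, 'v) gmodule \<Rightarrow> ('o, 'g, 'w) gmodule \<Rightarrow> ('o, 'g, 'v \<Rightarrow> 'w) gmodule" where
  "hom_gmodule G V W = \<lparr>sp = (\<lambda>e. op_space (sp V e) (sp W e)),
     act = (\<lambda>g f. \<lambda>v\<in>carrier (sp V (tgt G g)). act W g (f (act V (ginv G g) v)))\<rparr>"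

definition dual_gmodule ::
  "('o, 'g) groupoid \<Rightarrow> ('o, 'g, 'v) gmodule \<Rightarrow> ('o, 'g, 'v \<Rightarrow> real) gmodule" where
  "dual_gmodule G V = hom_gmodule G V triv_gmodule"

definition invariants ::
  "('o, 'g) groupoid \<Rightarrow> ('o, 'g, 'v) gmodule \<Rightarrow> ('o \<Rightarrow> 'v) nspace" where
  "invariants G V = mk_nspace
     {v \<in> \<Pi>\<^sub>E e\<in>ob G. carrier (sp V e).
        (\<forall>g \<in> mor G. act V g (v (src G g)) = v (tgt G g)) \<and>
        bdd_above ((\<lambda>e. nrm (sp V e) (v e)) ` ob G)}
     (\<lambda>e\<in>ob G. \<zero>\<^bsub>sp V e\<^esub>) (\<lambda>v w. \<lambda>e\<in>ob G. v e \<oplus>\<^bsub>sp V e\<^esub> w e)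
     (\<lambda>a v. \<lambda>e\<in>ob G. a \<odot>\<^bsub>sp V e\<^esub> v e)
     (\<lambda>v. sup0 ((\<lambda>e. nrm (sp V e) (v e)) ` ob G))"

definition BG ::
  "('o, 'g) groupoid \<Rightarrow> ('o, 'g, 'v) gmodule \<Rightarrow> ('o, 'g, 'w) gmodule \<Rightarrow> ('o \<Rightarrow> 'v \<Rightarrow> 'w) nspace" where
  "BG G V W = invariants G (hom_gmodule G V W)"

definition gmap ::
  "('o, 'g) groupoid \<Rightarrow> ('o, 'g, 'v) gmodule \<Rightarrow> ('o, 'g, 'w) gmodule \<Rightarrow> ('o \<Rightarrow> 'v \<Rightarrow> 'w) \<Rightarrow> bool" where
  "gmap G V W f \<longleftrightarrow>
     (\<forall>e \<in> ob G. bounded_linear_on (sp V e) (sp W e) (f e)) \<and>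
     (\<forall>g \<in> mor G. \<forall>v \<in> carrier (sp V (src G g)).
        f (tgt G g) (act V g v) = act W g (f (src G g) v)) \<and>
     bdd_above ((\<lambda>e. op_nrm (sp V e) (sp W e) (f e)) ` ob G)"

definition gmap_nrm ::
  "('o, 'g) groupoid \<Rightarrow> ('o, 'g, 'v) gmodule \<Rightarrow> ('o, 'g, 'w) gmodule \<Rightarrow> ('o \<Rightarrow> 'v \<Rightarrow> 'w) \<Rightarrow> real" where
  "gmap_nrm G V W f = sup0 ((\<lambda>e. op_nrm (sp V e) (sp W e) (f e)) ` ob G)"

section \<open>Amenability\<close>

definition fibre :: "('o, 'g) groupoid \<Rightarrow> 'o \<Rightarrow> 'g set" where
  "fibre G e = {h \<in> mor G. tgt G h = e}"

definition linf_gmodule :: "('o, 'g) groupoid \<Rightarrow> ('o, 'g, 'g \<Rightarrow> real) gmodule" where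
  "linf_gmodule G = \<lparr>sp = (\<lambda>e. linf_space (fibre G e)),
     act = (\<lambda>g \<phi>. \<lambda>h\<in>fibre G (tgt G g). \<phi> (cmp G (ginv G g) h))\<rparr>"

definition amenable :: "('o, 'g) groupoid \<Rightarrow> bool" where
  "amenable G \<longleftrightarrow> (\<exists>m. gmap G (linf_gmodule G) triv_gmodule m \<and>
     gmap_nrm G (linf_gmodule G) triv_gmodule m = 1 \<and>
     (\<forall>e \<in> ob G. \<forall>a. m e (\<lambda>h\<in>fibre G e. a) = a))"

section \<open>Bounded cohomology\<close>

text \<open>The tuple \<open>(g\<^sub>0, \<dots>, g\<^sub>n)\<close> is the list of length \<open>n + 1\<close> with these entries.\<close>

definition paths :: "('o, 'g) groupoid \<Rightarrow> nat \<Rightarrow> 'o \<Rightarrow> 'g list set" where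
  "paths G n e = {x. length x = Suc n \<and> set x \<subseteq> mor G \<and>
     (\<forall>i<n. src G (x ! i) = tgt G (x ! Suc i)) \<and> tgt G (x ! 0) = e}"

definition chain_gmodule :: "('o, 'g) groupoid \<Rightarrow> nat \<Rightarrow> ('o, 'g, 'g list \<Rightarrow> real) gmodule" where
  "chain_gmodule G n = \<lparr>sp = (\<lambda>e. l1_free_space (paths G n e)),
     act = (\<lambda>g. lin_ext (\<lambda>x. indicat_real {cmp G g (hd x) # tl x}))\<rparr>"

definition merge :: "('o, 'g) groupoid \<Rightarrow> nat \<Rightarrow> 'g list \<Rightarrow> 'g list" where
  "merge G i x = take i x @ cmp G (x ! i) (x ! Suc i) # drop (i + 2) x"

text \<open>Meaningful for \<open>n \<ge> 1\<close>; the last face drops the final entry of the tuple.\<close>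

definition boundary :: "('o, 'g) groupoid \<Rightarrow> nat \<Rightarrow> ('g list \<Rightarrow> real) \<Rightarrow> 'g list \<Rightarrow> real" where
  "boundary G n = lin_ext (\<lambda>x y.
     (\<Sum>i<n. (- 1) ^ i * indicat_real {merge G i x} y) + (- 1) ^ n * indicat_real {butlast x} y)"

definition cochains ::
  "('o, 'g) groupoid \<Rightarrow> ('o, 'g, 'v) gmodule \<Rightarrow> nat \<Rightarrow> ('o \<Rightarrow> ('g list \<Rightarrow> real) \<Rightarrow> 'v) nspace" where
  "cochains G V n = BG G (chain_gmodule G n) V"

text \<open>Precomposition with \<open>\<partial>\<^sub>n\<^sub>+\<^sub>1\<close>, from degree \<open>n\<close> to degree \<open>n + 1\<close>. No sign is
  inserted; a sign would change neither kernels nor images.\<close>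

definition coboundary :: "('o, 'g) groupoid \<Rightarrow> nat \<Rightarrow>
    ('o \<Rightarrow> ('g list \<Rightarrow> real) \<Rightarrow> 'v) \<Rightarrow> 'o \<Rightarrow> ('g list \<Rightarrow> real) \<Rightarrow> 'v" where
  "coboundary G n f = (\<lambda>e\<in>ob G. \<lambda>c\<in>carrier (sp (chain_gmodule G (Suc n)) e).
     f e (boundary G (Suc n) c))"

definition cocycles ::
  "('o, 'g) groupoid \<Rightarrow> ('o, 'g, 'v) gmodule \<Rightarrow> nat \<Rightarrow> ('o \<Rightarrow> ('g list \<Rightarrow> real) \<Rightarrow> 'v) set" where
  "cocycles G V n =
     kernel (add_monoid (cochains G V n)) (add_monoid (cochains G V (Suc n))) (coboundary G n)"

fun coboundaries ::
  "('o, 'g) groupoid \<Rightarrow> ('o, 'g, 'v) gmodule \<Rightarrow> nat \<Rightarrow> ('o \<Rightarrow> ('g list \<Rightarrow> real) \<Rightarrow> 'v) set" where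
  "coboundaries G V 0 = {\<zero>\<^bsub>cochains G V 0\<^esub>}"
| "coboundaries G V (Suc n) = coboundary G n ` carrier (cochains G V n)"

text \<open>Cocycles modulo coboundaries, as an additive group.\<close>

definition bounded_cohomology :: "('o, 'g) groupoid \<Rightarrow> ('o, 'g, 'v) gmodule \<Rightarrow> nat \<Rightarrow>
    ('o \<Rightarrow> ('g list \<Rightarrow> real) \<Rightarrow> 'v) set monoid" where
  "bounded_cohomology G V n =
     subgroup_generated (add_monoid (cochains G V n)) (cocycles G V n) Mod coboundaries G V n"

end

theory Submission
  imports Defs
begin

text \<open>Averaging over a mean \<open>m\<close> contracts the complex. Prepending a morphism \<open>h\<close> with the right
  target, \<open>(g\<^sub>0, \<dots>, g\<^sub>n) \<mapsto> (h, h\<^sup>-\<^sup>1 g\<^sub>0, g\<^sub>1, \<dots>, g\<^sub>n)\<close>, is a contracting homotopy \<open>s\<^sub>h\<close> of the bar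
  complex, but it is not equivariant: \<open>g \<cdot> s\<^sub>h(c) = s\<^sub>g\<^sub>h(g \<cdot> c)\<close>. For a cocycle \<open>f\<close> with values in
  \<open>V'\<close>, the cochain \<open>b(c)(v) = m(h \<mapsto> f(s\<^sub>h c)(v))\<close> is equivariant because \<open>m\<close> is, and
  \<open>f(s\<^sub>h (\<partial> c)) = f(c) - f(\<partial> (s\<^sub>h c)) = f(c)\<close> does not depend on \<open>h\<close>, so \<open>b\<close> has coboundary \<open>f\<close>.\<close>

section \<open>Normed spaces with explicit carrier\<close>

text \<open>Dual coefficients make the averaging possible: \<open>m\<close> accepts only bounded
  real functions on a fibre, so the value of a cochain in \<open>V'\<close> is evaluated at a vector
  \<open>v\<close>, and the averages for all \<open>v\<close> together form a functional again. As a
  function of \<open>h\<close> the integrand is bounded by a bound for \<open>f\<close> times the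
  norms of \<open>c\<close> and \<open>v\<close>, because prepending \<open>h\<close> has norm at
  most 1 on l1-chains, whatever \<open>h\<close> is. Replacing \<open>h\<close> by \<open>gh\<close>
  maps the fibre over the source of \<open>g\<close> onto the fibre over its target, and this is the
  translation under which \<open>m\<close> is invariant. The homotopy identity is applied to chains
  of the degree of the cocycle. In degree 0 its second term is the cone on the augmentation, which
  does not belong to the complex; this is where positivity of the degree enters. Invariant families
  have to be bounded uniformly over all objects, so estimates are carried out with one constant for
  all objects. Elements of the operator spaces and cochains are extensional functions, so their
  equality is tested on carriers, and a cochain is obtained by restricting an equivariant
  family.\<close>

lemma mk_nspace_simps [simp]:
  "carrier (mk_nspace C z a s N) = C"
  "\<zero>\<^bsub>mk_nspace C z a s N\<^esub> = z"
  "x \<oplus>\<^bsub>mk_nspace C z a s N\<^esub> y = a x y"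
  "r \<odot>\<^bsub>mk_nspace C z a s N\<^esub> x = s r x"
  "nrm (mk_nspace C z a s N) x = N x"
  by (simp_all add: mk_nspace_def)

lemma real_space_simps [simp]:
  "carrier real_space = UNIV"
  "\<zero>\<^bsub>real_space\<^esub> = 0"
  "x \<oplus>\<^bsub>real_space\<^esub> y = x + y"
  "r \<odot>\<^bsub>real_space\<^esub> x = r * x"
  "nrm real_space x = \<bar>x\<bar>"
  by (simp_all add: real_space_def)

text \<open>Negatives are taken to be scalar multiples by -1, so an instance needs no separate
  negation operation.\<close>

lemma abelian_group_mk_nspaceI:
  assumes zero: "z \<in> C" and add: "\<And>x y. \<lbrakk>x \<in> C; y \<in> C\<rbrakk> \<Longrightarrow> a x y \<in> C"
    and smult: "\<And>r x. x \<in> C \<Longrightarrow> s r x \<in> C"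
    and assoc: "\<And>x y w. \<lbrakk>x \<in> C; y \<in> C; w \<in> C\<rbrakk> \<Longrightarrow> a (a x y) w = a x (a y w)"
    and comm: "\<And>x y. \<lbrakk>x \<in> C; y \<in> C\<rbrakk> \<Longrightarrow> a x y = a y x"
    and zero_left: "\<And>x. x \<in> C \<Longrightarrow> a z x = x"
    and inverse: "\<And>x. x \<in> C \<Longrightarrow> a (s (- 1) x) x = z"
  shows "abelian_group (mk_nspace C z a s N)"
proof (rule abelian_groupI)
  fix x assume "x \<in> carrier (mk_nspace C z a s N)"
  then show "\<exists>y\<in>carrier (mk_nspace C z a s N).
      y \<oplus>\<^bsub>mk_nspace C z a s N\<^esub> x = \<zero>\<^bsub>mk_nspace C z a s N\<^esub>"
    using inverse smult by auto
qed (use assms in auto)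

text \<open>The scalar ring record is unfolded here once and for all; instances then check laws
  stated with \<open>+\<close> and \<open>*\<close> on the reals.\<close>

lemma normed_space_on_mk_nspaceI:
  assumes "abelian_group (mk_nspace C z a s N)"
    and "\<And>r x. x \<in> C \<Longrightarrow> s r x \<in> C"
    and "\<And>r q x. x \<in> C \<Longrightarrow> s (r + q) x = a (s r x) (s q x)"
    and "\<And>r x y. \<lbrakk>x \<in> C; y \<in> C\<rbrakk> \<Longrightarrow> s r (a x y) = a (s r x) (s r y)"
    and "\<And>r q x. x \<in> C \<Longrightarrow> s (r * q) x = s r (s q x)"
    and "\<And>x. x \<in> C \<Longrightarrow> s 1 x = x"
    and "\<And>x. \<lbrakk>x \<in> C; N x = 0\<rbrakk> \<Longrightarrow> x = z" and "N z = 0"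
    and "\<And>x. x \<in> C \<Longrightarrow> 0 \<le> N x"
    and "\<And>x y. \<lbrakk>x \<in> C; y \<in> C\<rbrakk> \<Longrightarrow> N (a x y) \<le> N x + N y"
    and "\<And>r x. x \<in> C \<Longrightarrow> N (s r x) = \<bar>r\<bar> * N x"
  shows "normed_space_on (mk_nspace C z a s N)"
  by (intro normed_space_on.intro normed_space_on_axioms.intro moduleI cring_from_type_algebra)
    (use assms in \<open>auto simp: ring_of_type_algebra_def\<close>)

lemma normed_space_on_real_space: "normed_space_on real_space"
  unfolding real_space_def
  by (intro normed_space_on_mk_nspaceI abelian_group_mk_nspaceI)
    (auto simp: algebra_simps abs_mult)

context normed_space_on
begin

lemma
  shows smult_in: "x \<in> carrier V \<Longrightarrow> r \<odot>\<^bsub>V\<^esub> x \<in> carrier V"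
    and add_smult: "x \<in> carrier V \<Longrightarrow> (r + q) \<odot>\<^bsub>V\<^esub> x = r \<odot>\<^bsub>V\<^esub> x \<oplus> q \<odot>\<^bsub>V\<^esub> x"
    and smult_add: "\<lbrakk>x \<in> carrier V; y \<in> carrier V\<rbrakk> \<Longrightarrow> r \<odot>\<^bsub>V\<^esub> (x \<oplus> y) = r \<odot>\<^bsub>V\<^esub> x \<oplus> r \<odot>\<^bsub>V\<^esub> y"
    and smult_smult: "x \<in> carrier V \<Longrightarrow> r \<odot>\<^bsub>V\<^esub> (q \<odot>\<^bsub>V\<^esub> x) = (r * q) \<odot>\<^bsub>V\<^esub> x"
    and one_smult: "x \<in> carrier V \<Longrightarrow> 1 \<odot>\<^bsub>V\<^esub> x = x"
    and nrm_zero: "nrm V \<zero>\<^bsub>V\<^esub> = 0"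
  using smult_closed[of r x] smult_l_distr[of r q x] smult_r_distr[of r x y]
    smult_assoc1[of r q x] smult_one[of x] nrm_eq_0[of "\<zero>\<^bsub>V\<^esub>"]
  by (auto simp: ring_of_type_algebra_def)

text \<open>The norm decides it: the norm of the product is 0 by homogeneity, and definiteness does
  the rest.\<close>

lemma zero_smult:
  assumes "x \<in> carrier V" shows "0 \<odot>\<^bsub>V\<^esub> x = \<zero>\<^bsub>V\<^esub>"
  using nrm_smult[OF assms, of 0] nrm_eq_0[of "0 \<odot>\<^bsub>V\<^esub> x"] smult_in[OF assms] by simp

lemma neg_smult_add:
  assumes "x \<in> carrier V" shows "(- 1) \<odot>\<^bsub>V\<^esub> x \<oplus> x = \<zero>\<^bsub>V\<^esub>"
  using add_smult[OF assms, of "- 1" 1] one_smult[OF assms] zero_smult[OF assms] by simp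

lemma smult_zero: "r \<odot>\<^bsub>V\<^esub> \<zero>\<^bsub>V\<^esub> = \<zero>\<^bsub>V\<^esub>"
  using smult_smult[OF M.zero_closed, of r 0] zero_smult[OF M.zero_closed] by simp

end

lemma linear_onD:
  assumes "linear_on V W f"
  shows "x \<in> carrier V \<Longrightarrow> f x \<in> carrier W"
    and "\<lbrakk>x \<in> carrier V; y \<in> carrier V\<rbrakk> \<Longrightarrow> f (x \<oplus>\<^bsub>V\<^esub> y) = f x \<oplus>\<^bsub>W\<^esub> f y"
    and "x \<in> carrier V \<Longrightarrow> f (r \<odot>\<^bsub>V\<^esub> x) = r \<odot>\<^bsub>W\<^esub> f x"
  using assms by (auto simp: linear_on_def)

lemma linear_onI:
  assumes "\<And>x. x \<in> carrier V \<Longrightarrow> f x \<in> carrier W"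
    and "\<And>x y. \<lbrakk>x \<in> carrier V; y \<in> carrier V\<rbrakk> \<Longrightarrow> f (x \<oplus>\<^bsub>V\<^esub> y) = f x \<oplus>\<^bsub>W\<^esub> f y"
    and "\<And>r x. x \<in> carrier V \<Longrightarrow> f (r \<odot>\<^bsub>V\<^esub> x) = r \<odot>\<^bsub>W\<^esub> f x"
  shows "linear_on V W f"
  using assms by (auto simp: linear_on_def)

text \<open>\<open>linear_on\<close> does not list preservation of zero. It follows from
  homogeneity, since the zero vector is 0 times itself.\<close>

lemma linear_on_zero:
  assumes "normed_space_on V" "normed_space_on W" "linear_on V W f"
  shows "f \<zero>\<^bsub>V\<^esub> = \<zero>\<^bsub>W\<^esub>"
proof -
  interpret V: normed_space_on V by fact
  interpret W: normed_space_on W by fact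
  show ?thesis
    using linear_onD(3)[OF assms(3) V.M.zero_closed, of 0] linear_onD(1)[OF assms(3) V.M.zero_closed]
    by (simp add: V.zero_smult V.M.zero_closed W.zero_smult)
qed

lemma bounded_linear_onD:
  assumes "bounded_linear_on V W f"
  shows "linear_on V W f" and "x \<in> carrier V \<Longrightarrow> f x \<in> carrier W"
  using assms by (auto simp: bounded_linear_on_def dest: linear_onD(1))

section \<open>Suprema, operator norms and spaces of bounded linear maps\<close>

lemma sup0_nonneg: "bdd_above A \<Longrightarrow> 0 \<le> sup0 A"
  unfolding sup0_def by (intro cSup_upper) auto

lemma le_sup0: "\<lbrakk>bdd_above A; x \<in> A\<rbrakk> \<Longrightarrow> x \<le> sup0 A"
  unfolding sup0_def by (intro cSup_upper) auto

text \<open>The inserted 0 keeps the set nonempty at the price of the premise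
  \<open>0 \<le> K\<close>, so families over an empty index set need no special treatment.\<close>

lemma sup0_le: "\<lbrakk>\<And>x. x \<in> A \<Longrightarrow> x \<le> K; 0 \<le> K\<rbrakk> \<Longrightarrow> sup0 A \<le> K"
  unfolding sup0_def by (intro cSup_least) auto

lemma op_nrm_le:
  assumes "normed_space_on V" "\<And>x. x \<in> carrier V \<Longrightarrow> nrm W (f x) \<le> K * nrm V x" "0 \<le> K"
  shows "op_nrm V W f \<le> K"
  unfolding op_nrm_def
proof (rule sup0_le)
  interpret normed_space_on V by fact
  fix y assume "y \<in> (\<lambda>x. nrm W (f x) / nrm V x) ` carrier V"
  then obtain x where "x \<in> carrier V" "y = nrm W (f x) / nrm V x" by auto
  \<comment> \<open>At norm 0 the quotient is 0 by the convention for division, and the claim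
    becomes \<open>0 \<le> K\<close>.\<close>
  then show "y \<le> K"
    using assms(2)[of x] nrm_nonneg[of x] \<open>0 \<le> K\<close>
    by (cases "nrm V x = 0") (auto simp: pos_divide_le_eq)
qed fact

lemma bdd_above_op_nrm:
  assumes "normed_space_on V" "bounded_linear_on V W f"
  shows "bdd_above ((\<lambda>x. nrm W (f x) / nrm V x) ` carrier V)"
proof -
  interpret normed_space_on V by fact
  obtain K where K: "\<And>x. x \<in> carrier V \<Longrightarrow> nrm W (f x) \<le> K * nrm V x"
    using assms(2) by (auto simp: bounded_linear_on_def)
  \<comment> \<open>The constant in \<open>bounded_linear_on\<close> carries no sign. Passing to
    \<open>max K 0\<close> also covers the value 0 of the quotient at vectors of norm 0.\<close>
  have "nrm W (f x) / nrm V x \<le> max K 0" if "x \<in> carrier V" for x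
    using K[OF that] nrm_nonneg[OF that]
    by (cases "nrm V x = 0")
      (auto simp: divide_simps max_def not_le intro: order_trans[OF K[OF that]] mult_nonpos_nonneg)
  then show ?thesis by (intro bdd_aboveI2)
qed

lemma op_nrm_nonneg:
  "\<lbrakk>normed_space_on V; bounded_linear_on V W f\<rbrakk> \<Longrightarrow> 0 \<le> op_nrm V W f"
  unfolding op_nrm_def by (intro sup0_nonneg bdd_above_op_nrm)

text \<open>Away from the zero vector this is the definition multiplied out. At the zero vector the
  quotient carries no information, and the bound holds because linear maps preserve zero.\<close>

lemma nrm_le_op_nrm:
  assumes "normed_space_on V" "normed_space_on W" "bounded_linear_on V W f" "x \<in> carrier V"
  shows "nrm W (f x) \<le> op_nrm V W f * nrm V x"
proof (cases "nrm V x = 0")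
  case True
  interpret V: normed_space_on V by fact
  interpret W: normed_space_on W by fact
  have "f x = \<zero>\<^bsub>W\<^esub>"
    using True linear_on_zero[OF assms(1,2)] V.nrm_eq_0[OF \<open>x \<in> carrier V\<close>] assms(3)
    by (auto dest: bounded_linear_onD)
  then show ?thesis by (simp add: True W.nrm_zero)
next
  case False
  interpret V: normed_space_on V by fact
  have "nrm W (f x) / nrm V x \<le> op_nrm V W f"
    unfolding op_nrm_def using assms by (intro le_sup0 bdd_above_op_nrm) auto
  then show ?thesis
    using False V.nrm_nonneg[OF \<open>x \<in> carrier V\<close>] by (simp add: pos_divide_le_eq)
qed

lemma op_space_simps [simp]:
  "carrier (op_space V W) = {f \<in> extensional (carrier V). bounded_linear_on V W f}"
  "\<zero>\<^bsub>op_space V W\<^esub> = (\<lambda>x\<in>carrier V. \<zero>\<^bsub>W\<^esub>)"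
  "f \<oplus>\<^bsub>op_space V W\<^esub> g = (\<lambda>x\<in>carrier V. f x \<oplus>\<^bsub>W\<^esub> g x)"
  "r \<odot>\<^bsub>op_space V W\<^esub> f = (\<lambda>x\<in>carrier V. r \<odot>\<^bsub>W\<^esub> f x)"
  "nrm (op_space V W) f = op_nrm V W f"
  by (simp_all add: op_space_def)

lemma normed_space_on_op_space:
  assumes "normed_space_on V" "normed_space_on W"
  shows "normed_space_on (op_space V W)"
proof -
  interpret V: normed_space_on V by fact
  interpret W: normed_space_on W by fact
  let ?C = "{f \<in> extensional (carrier V). bounded_linear_on V W f}"
  note bound = nrm_le_op_nrm[OF assms]
  have blI: "bounded_linear_on V W f"
    if "linear_on V W f" "\<And>x. x \<in> carrier V \<Longrightarrow> nrm W (f x) \<le> K * nrm V x" for f K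
    using that by (auto simp: bounded_linear_on_def)
  have zero: "(\<lambda>x\<in>carrier V. \<zero>\<^bsub>W\<^esub>) \<in> ?C"
    by (auto intro!: blI[of _ 0] linear_onI simp: V.smult_in W.smult_in W.smult_zero W.nrm_zero)
  have in_W: "f x \<in> carrier W" if "f \<in> ?C" "x \<in> carrier V" for f x
    using that by (auto dest: bounded_linear_onD(2))
  have add_le: "nrm W (f x \<oplus>\<^bsub>W\<^esub> g x) \<le> (op_nrm V W f + op_nrm V W g) * nrm V x"
    if "f \<in> ?C" "g \<in> ?C" "x \<in> carrier V" for f g x
    using W.nrm_triangle[of "f x" "g x"] bound[of f x] bound[of g x] that in_W[of f x] in_W[of g x]
    by (auto simp: algebra_simps)
  have add: "(\<lambda>x\<in>carrier V. f x \<oplus>\<^bsub>W\<^esub> g x) \<in> ?C" if "f \<in> ?C" "g \<in> ?C" for f g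
  proof -
    have "linear_on V W (\<lambda>x\<in>carrier V. f x \<oplus>\<^bsub>W\<^esub> g x)"
      using that bounded_linear_onD[of V W f] bounded_linear_onD[of V W g]
      by (auto intro!: linear_onI
          simp: V.smult_in W.smult_in linear_onD W.smult_add W.a_ac)
    then show ?thesis using add_le[OF that] by (auto intro!: blI)
  qed
  have smult_le: "nrm W (r \<odot>\<^bsub>W\<^esub> f x) \<le> (\<bar>r\<bar> * op_nrm V W f) * nrm V x"
    if "f \<in> ?C" "x \<in> carrier V" for r f x
    using bound[of f x] that in_W[of f x]
    by (auto simp: W.nrm_smult mult_left_mono mult.assoc)
  have smult: "(\<lambda>x\<in>carrier V. r \<odot>\<^bsub>W\<^esub> f x) \<in> ?C" if "f \<in> ?C" for r f
  proof -
    have "linear_on V W (\<lambda>x\<in>carrier V. r \<odot>\<^bsub>W\<^esub> f x)"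
      using that bounded_linear_onD[of V W f]
      by (auto intro!: linear_onI
          simp: V.smult_in W.smult_in linear_onD W.smult_add W.smult_smult mult.commute)
    then show ?thesis using smult_le[OF that] by (auto intro!: blI)
  qed
  have nonneg: "0 \<le> op_nrm V W f" if "f \<in> ?C" for f
    using that by (intro op_nrm_nonneg assms) auto
  have nrm_smult_le: "op_nrm V W (\<lambda>x\<in>carrier V. r \<odot>\<^bsub>W\<^esub> f x) \<le> \<bar>r\<bar> * op_nrm V W f"
    if "f \<in> ?C" for r f
    using smult_le[OF that] nonneg[OF that] by (intro op_nrm_le assms) auto
  have eqI: "f = g" if "f \<in> ?C" "g \<in> ?C" "\<And>x. x \<in> carrier V \<Longrightarrow> f x = g x" for f g
    using that by (auto intro: extensionalityI)
  show ?thesis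
    unfolding op_space_def
  proof (intro normed_space_on_mk_nspaceI abelian_group_mk_nspaceI;
      (rule zero add smult nonneg; assumption)?)
    fix f assume f: "f \<in> ?C"
    { assume "op_nrm V W f = 0"
      then have "f x = \<zero>\<^bsub>W\<^esub>" if "x \<in> carrier V" for x
        using bound[of f x] f that W.nrm_nonneg[of "f x"] W.nrm_eq_0[of "f x"] in_W[OF f that] by auto
      then show "f = (\<lambda>x\<in>carrier V. \<zero>\<^bsub>W\<^esub>)" by (intro eqI[OF f zero]) auto }
    show "op_nrm V W (\<lambda>x\<in>carrier V. r \<odot>\<^bsub>W\<^esub> f x) = \<bar>r\<bar> * op_nrm V W f" for r
    proof (cases "r = 0")
      case True
      then show ?thesis
        using nrm_smult_le[OF f, of r] nonneg[OF smult[OF f, of r]] by auto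
    next
      case False
      let ?g = "\<lambda>x\<in>carrier V. r \<odot>\<^bsub>W\<^esub> f x"
      \<comment> \<open>The inequality \<open>nrm_smult_le\<close> becomes an equality by applying
        it a second time, with the scalar \<open>inverse r\<close> and the map
        \<open>?g\<close>.\<close>
      have "(\<lambda>x\<in>carrier V. inverse r \<odot>\<^bsub>W\<^esub> ?g x) = f"
        using False smult[OF smult[OF f, of r], of "inverse r"]
        by (intro eqI f) (auto simp: W.smult_smult W.one_smult in_W[OF f])
      then have "op_nrm V W f \<le> \<bar>inverse r\<bar> * op_nrm V W ?g"
        using nrm_smult_le[OF smult[OF f, of r], of "inverse r"] by simp
      then have "\<bar>r\<bar> * op_nrm V W f \<le> op_nrm V W ?g"
        using False by (auto simp: field_simps)
      then show ?thesis using nrm_smult_le[OF f, of r] by simp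
    qed
    fix g assume g: "g \<in> ?C"
    show "op_nrm V W (\<lambda>x\<in>carrier V. f x \<oplus>\<^bsub>W\<^esub> g x) \<le> op_nrm V W f + op_nrm V W g"
      using add_le[OF f g] nonneg[OF f] nonneg[OF g] by (intro op_nrm_le assms) auto
  qed (use zero in \<open>auto intro!: op_nrm_le[OF assms(1), of _ _ 0, THEN antisym]
      op_nrm_nonneg[OF assms(1)] extensionalityI[of _ "carrier V"]
      restrict_ext W.add_smult W.smult_add W.smult_smult[symmetric] W.a_comm W.a_assoc
      simp: in_W W.one_smult W.neg_smult_add W.nrm_zero\<close>)
qed

section \<open>Finitely supported functions and linear extension\<close>

lemma l1_free_space_simps [simp]:
  "carrier (l1_free_space S) = {c. finite {x. c x \<noteq> 0} \<and> {x. c x \<noteq> 0} \<subseteq> S}"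
  "\<zero>\<^bsub>l1_free_space S\<^esub> = (\<lambda>x. 0)"
  "c \<oplus>\<^bsub>l1_free_space S\<^esub> d = (\<lambda>x. c x + d x)"
  "r \<odot>\<^bsub>l1_free_space S\<^esub> c = (\<lambda>x. r * c x)"
  "nrm (l1_free_space S) c = (\<Sum>x | c x \<noteq> 0. \<bar>c x\<bar>)"
  by (simp_all add: l1_free_space_def)

text \<open>The index set of the norm is the support and varies with \<open>c\<close>. Passing to a
  common finite superset allows sums for different functions to be compared termwise;
  \<open>lin_ext_eq\<close> does the same for \<open>lin_ext\<close>.\<close>

lemma l1_nrm_eq:
  fixes c :: "'a \<Rightarrow> real"
  assumes "finite A" "{x. c x \<noteq> 0} \<subseteq> A"
  shows "(\<Sum>x | c x \<noteq> 0. \<bar>c x\<bar>) = (\<Sum>x\<in>A. \<bar>c x\<bar>)"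
  using assms by (intro sum.mono_neutral_left) auto

lemma normed_space_on_l1_free_space: "normed_space_on (l1_free_space S)"
  unfolding l1_free_space_def
proof (intro normed_space_on_mk_nspaceI abelian_group_mk_nspaceI)
  fix c d :: "'a \<Rightarrow> real"
  assume c: "c \<in> {c. finite {x. c x \<noteq> 0} \<and> {x. c x \<noteq> 0} \<subseteq> S}"
    and d: "d \<in> {c. finite {x. c x \<noteq> 0} \<and> {x. c x \<noteq> 0} \<subseteq> S}"
  \<comment> \<open>The union of the two supports contains the support of the sum as well, so all
    three norms become sums over it.\<close>
  let ?A = "{x. c x \<noteq> 0} \<union> {x. d x \<noteq> 0}"
  have fin: "finite ?A" using c d by auto
  show "(\<lambda>x. c x + d x) \<in> {c. finite {x. c x \<noteq> 0} \<and> {x. c x \<noteq> 0} \<subseteq> S}"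
  proof -
    have sub: "{x. c x + d x \<noteq> 0} \<subseteq> ?A" by auto
    then show ?thesis using c d finite_subset[OF sub fin] by auto
  qed
  have "(\<Sum>x | c x + d x \<noteq> 0. \<bar>c x + d x\<bar>) = (\<Sum>x\<in>?A. \<bar>c x + d x\<bar>)"
    by (intro l1_nrm_eq fin) auto
  also have "\<dots> \<le> (\<Sum>x\<in>?A. \<bar>c x\<bar>) + (\<Sum>x\<in>?A. \<bar>d x\<bar>)"
    by (simp add: sum.distrib[symmetric] sum_mono)
  also have "\<dots> = (\<Sum>x | c x \<noteq> 0. \<bar>c x\<bar>) + (\<Sum>x | d x \<noteq> 0. \<bar>d x\<bar>)"
    using fin by (intro arg_cong2[of _ _ _ _ "(+)"] l1_nrm_eq[symmetric]) auto
  finally show "(\<Sum>x | c x + d x \<noteq> 0. \<bar>c x + d x\<bar>) \<le>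
      (\<Sum>x | c x \<noteq> 0. \<bar>c x\<bar>) + (\<Sum>x | d x \<noteq> 0. \<bar>d x\<bar>)" .
next
  fix r :: real and c :: "'a \<Rightarrow> real"
  assume c: "c \<in> {c. finite {x. c x \<noteq> 0} \<and> {x. c x \<noteq> 0} \<subseteq> S}"
  \<comment> \<open>For \<open>r = 0\<close> the support collapses to the empty set; otherwise it
    agrees with that of \<open>c\<close>.\<close>
  then show "(\<Sum>x | r * c x \<noteq> 0. \<bar>r * c x\<bar>) = \<bar>r\<bar> * (\<Sum>x | c x \<noteq> 0. \<bar>c x\<bar>)"
    by (cases "r = 0") (auto simp: abs_mult sum_distrib_left)
  then show "(\<lambda>x. r * c x) \<in> {c. finite {x. c x \<noteq> 0} \<and> {x. c x \<noteq> 0} \<subseteq> S}"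
    using c by (cases "r = 0") auto
  assume "(\<Sum>x | c x \<noteq> 0. \<bar>c x\<bar>) = 0"
  then show "c = (\<lambda>x. 0)" using c by (auto simp: sum_nonneg_eq_0_iff)
qed (auto simp: algebra_simps intro!: sum_nonneg)

lemma lin_ext_eq:
  assumes "finite A" "{x. c x \<noteq> 0} \<subseteq> A"
  shows "lin_ext \<phi> c y = (\<Sum>x\<in>A. c x * \<phi> x y)"
  unfolding lin_ext_def using assms by (intro sum.mono_neutral_left) auto

lemma lin_ext_cong: "(\<And>x. c x \<noteq> 0 \<Longrightarrow> \<phi> x = \<psi> x) \<Longrightarrow> lin_ext \<phi> c = lin_ext \<psi> c"
  unfolding lin_ext_def by (intro ext sum.cong) auto

lemma lin_ext_zero [simp]: "lin_ext \<phi> (\<lambda>x. 0) = (\<lambda>y. 0)"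
  by (simp add: lin_ext_def)

lemma sum_nonzeroD: "(\<Sum>i\<in>I. f i) \<noteq> 0 \<Longrightarrow> \<exists>i\<in>I. f i \<noteq> 0"
  by (meson sum.neutral)

text \<open>Sum, difference and scalar multiple are instances of this general form. Finiteness of
  the supports matters because a sum over an infinite index set is 0 by convention.\<close>

lemma lin_ext_sum:
  assumes "finite I" "\<And>i. i \<in> I \<Longrightarrow> finite {x. c i x \<noteq> 0}"
  shows "lin_ext \<phi> (\<lambda>x. \<Sum>i\<in>I. a i * c i x) = (\<lambda>y. \<Sum>i\<in>I. a i * lin_ext \<phi> (c i) y)"
proof
  fix y
  let ?A = "\<Union>i\<in>I. {x. c i x \<noteq> 0}"
  have fin: "finite ?A" using assms by auto
  have "lin_ext \<phi> (\<lambda>x. \<Sum>i\<in>I. a i * c i x) y = (\<Sum>x\<in>?A. (\<Sum>i\<in>I. a i * c i x) * \<phi> x y)"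
    by (intro lin_ext_eq fin) (auto dest!: sum_nonzeroD)
  also have "\<dots> = (\<Sum>i\<in>I. \<Sum>x\<in>?A. a i * c i x * \<phi> x y)"
    by (subst sum.swap) (simp add: sum_distrib_right)
  also have "\<dots> = (\<Sum>i\<in>I. a i * lin_ext \<phi> (c i) y)"
  proof (intro sum.cong refl)
    fix i assume "i \<in> I"
    then have "lin_ext \<phi> (c i) y = (\<Sum>x\<in>?A. c i x * \<phi> x y)" by (intro lin_ext_eq fin) auto
    then show "(\<Sum>x\<in>?A. a i * c i x * \<phi> x y) = a i * lin_ext \<phi> (c i) y"
      by (simp add: sum_distrib_left mult.assoc)
  qed
  finally show "lin_ext \<phi> (\<lambda>x. \<Sum>i\<in>I. a i * c i x) y = (\<Sum>i\<in>I. a i * lin_ext \<phi> (c i) y)" .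
qed

text \<open>Combinations of two terms are indexed by \<open>bool\<close>, with coefficients 1 and 1,
  or 1 and -1.\<close>

lemma
  assumes "finite {x. c x \<noteq> 0}" "finite {x. d x \<noteq> 0}"
  shows lin_ext_add: "lin_ext \<phi> (\<lambda>x. c x + d x) = (\<lambda>y. lin_ext \<phi> c y + lin_ext \<phi> d y)"
    and lin_ext_diff: "lin_ext \<phi> (\<lambda>x. c x - d x) = (\<lambda>y. lin_ext \<phi> c y - lin_ext \<phi> d y)"
  using lin_ext_sum[of "UNIV :: bool set" "\<lambda>b. if b then c else d" \<phi> "\<lambda>b. 1"]
    lin_ext_sum[of "UNIV :: bool set" "\<lambda>b. if b then c else d" \<phi> "\<lambda>b. if b then 1 else - 1"]
    assms by (simp_all add: UNIV_bool add.commute)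

lemma lin_ext_indicator [simp]: "lin_ext \<phi> (indicat_real {x}) = \<phi> x"
  by (auto simp: lin_ext_eq[of "{x}"] indicator_def)

lemma finite_support_indicator [simp]: "finite {y. indicat_real {x} y \<noteq> 0}"
  by (rule finite_subset[of _ "{x}"]) (auto simp: indicator_def)

lemma indicator_in_l1_free_space_iff [simp]:
  "indicat_real {x} \<in> carrier (l1_free_space S) \<longleftrightarrow> x \<in> S"
  by (auto simp: indicator_def)

lemma nrm_indicator: "nrm (l1_free_space S) (indicat_real {x}) = 1"
  by (simp add: l1_nrm_eq[of "{x}"] indicator_def)

lemma lin_ext_id:
  assumes "finite {x. c x \<noteq> 0}" shows "lin_ext (\<lambda>x. indicat_real {x}) c = c"
proof
  fix y
  \<comment> \<open>The point \<open>y\<close> is added to the support so that the sum collapses to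
    the term at \<open>y\<close> even if \<open>c y = 0\<close>.\<close>
  have "lin_ext (\<lambda>x. indicat_real {x}) c y = (\<Sum>x\<in>insert y {x. c x \<noteq> 0}. c x * indicat_real {x} y)"
    using assms by (intro lin_ext_eq) auto
  also have "\<dots> = (\<Sum>x\<in>insert y {x. c x \<noteq> 0}. if x = y then c x else 0)"
    by (intro sum.cong) (auto simp: indicator_def)
  also have "\<dots> = c y" using assms by simp
  finally show "lin_ext (\<lambda>x. indicat_real {x}) c y = c y" .
qed

text \<open>The outer extension passes through the finite sum that defines the inner one. Identities
  between maps of chains thereby reduce to identities on basis vectors.\<close>

lemma lin_ext_lin_ext:
  assumes "finite {x. c x \<noteq> 0}" "\<And>x. c x \<noteq> 0 \<Longrightarrow> finite {y. \<psi> x y \<noteq> 0}"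
  shows "lin_ext \<phi> (lin_ext \<psi> c) = lin_ext (\<lambda>x. lin_ext \<phi> (\<psi> x)) c"
  using lin_ext_sum[of "{x. c x \<noteq> 0}" \<psi> \<phi> c] assms by (simp add: lin_ext_def)

lemma lin_ext_add_fun:
  "lin_ext (\<lambda>x y. \<phi> x y + \<psi> x y) c = (\<lambda>y. lin_ext \<phi> c y + lin_ext \<psi> c y)"
  by (simp add: lin_ext_def algebra_simps sum.distrib)

text \<open>A linear map on a space with l1-norm is bounded by its values on the basis. The norm
  estimates for the action, the boundary and the cone all come from this.\<close>

lemma
  assumes c: "c \<in> carrier (l1_free_space S)"
    and \<phi>: "\<And>x. x \<in> S \<Longrightarrow> \<phi> x \<in> carrier (l1_free_space T)"
  shows lin_ext_closed: "lin_ext \<phi> c \<in> carrier (l1_free_space T)"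
    and nrm_lin_ext_le: "(\<And>x. x \<in> S \<Longrightarrow> nrm (l1_free_space T) (\<phi> x) \<le> K) \<Longrightarrow>
      nrm (l1_free_space T) (lin_ext \<phi> c) \<le> K * nrm (l1_free_space S) c"
proof -
  let ?A = "{x. c x \<noteq> 0}" and ?B = "\<Union>x\<in>{x. c x \<noteq> 0}. {y. \<phi> x y \<noteq> 0}"
  have A: "finite ?A" "?A \<subseteq> S" using c by auto
  have B: "finite ?B" "?B \<subseteq> T" using A \<phi> by fastforce+
  have sub: "{y. lin_ext \<phi> c y \<noteq> 0} \<subseteq> ?B"
    by (auto simp: lin_ext_def dest!: sum_nonzeroD)
  then show "lin_ext \<phi> c \<in> carrier (l1_free_space T)"
    using B finite_subset[OF sub] by auto
  assume K: "\<And>x. x \<in> S \<Longrightarrow> nrm (l1_free_space T) (\<phi> x) \<le> K"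
  have "nrm (l1_free_space T) (lin_ext \<phi> c) = (\<Sum>y\<in>?B. \<bar>\<Sum>x\<in>?A. c x * \<phi> x y\<bar>)"
    using l1_nrm_eq[OF B(1) sub] by (simp add: lin_ext_def)
  also have "\<dots> \<le> (\<Sum>y\<in>?B. \<Sum>x\<in>?A. \<bar>c x\<bar> * \<bar>\<phi> x y\<bar>)"
    by (intro sum_mono order_trans[OF sum_abs]) (simp add: abs_mult)
  also have "\<dots> = (\<Sum>x\<in>?A. \<bar>c x\<bar> * (\<Sum>y\<in>?B. \<bar>\<phi> x y\<bar>))"
    by (subst sum.swap) (simp add: sum_distrib_left)
  also have "\<dots> = (\<Sum>x\<in>?A. \<bar>c x\<bar> * nrm (l1_free_space T) (\<phi> x))"
  proof (intro sum.cong refl)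
    fix x assume "x \<in> ?A"
    then have "{y. \<phi> x y \<noteq> 0} \<subseteq> ?B" by auto
    then show "\<bar>c x\<bar> * (\<Sum>y\<in>?B. \<bar>\<phi> x y\<bar>) = \<bar>c x\<bar> * nrm (l1_free_space T) (\<phi> x)"
      using l1_nrm_eq[OF B(1), of "\<phi> x"] by simp
  qed
  also have "\<dots> \<le> (\<Sum>x\<in>?A. \<bar>c x\<bar> * K)"
    using A K by (intro sum_mono mult_left_mono) auto
  finally show "nrm (l1_free_space T) (lin_ext \<phi> c) \<le> K * nrm (l1_free_space S) c"
    by (simp add: sum_distrib_left mult.commute)
qed

lemma linear_on_lin_ext:
  assumes "\<And>x. x \<in> S \<Longrightarrow> \<phi> x \<in> carrier (l1_free_space T)"
  shows "linear_on (l1_free_space S) (l1_free_space T) (lin_ext \<phi>)"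
proof (rule linear_onI)
  fix r :: real and c assume c: "c \<in> carrier (l1_free_space S)"
  show "lin_ext \<phi> c \<in> carrier (l1_free_space T)" by (rule lin_ext_closed[OF c assms])
  show "lin_ext \<phi> (r \<odot>\<^bsub>l1_free_space S\<^esub> c) = r \<odot>\<^bsub>l1_free_space T\<^esub> lin_ext \<phi> c"
    using lin_ext_sum[of "{()}" "\<lambda>_. c" \<phi> "\<lambda>_. r"] c by simp
  fix d assume d: "d \<in> carrier (l1_free_space S)"
  show "lin_ext \<phi> (c \<oplus>\<^bsub>l1_free_space S\<^esub> d) = lin_ext \<phi> c \<oplus>\<^bsub>l1_free_space T\<^esub> lin_ext \<phi> d"
    using lin_ext_add[of c d \<phi>] c d by simp
qed

text \<open>The points \<open>p i\<close> may coincide, as the faces of a path can, and coefficients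
  may then cancel; hence only an inequality for the norm.\<close>

lemma
  assumes "finite I" "\<And>i. i \<in> I \<Longrightarrow> p i \<in> S"
  shows sum_indicator_closed:
      "(\<lambda>y. \<Sum>i\<in>I. a i * indicat_real {p i} y) \<in> carrier (l1_free_space S)"
    and nrm_sum_indicator_le:
      "nrm (l1_free_space S) (\<lambda>y. \<Sum>i\<in>I. a i * indicat_real {p i} y) \<le> (\<Sum>i\<in>I. \<bar>a i\<bar>)"
proof -
  have sub: "{y. (\<Sum>i\<in>I. a i * indicat_real {p i} y) \<noteq> 0} \<subseteq> p ` I"
    by (auto simp: indicator_def dest!: sum_nonzeroD)
  then show "(\<lambda>y. \<Sum>i\<in>I. a i * indicat_real {p i} y) \<in> carrier (l1_free_space S)"
    using assms finite_subset[OF sub] by auto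
  \<comment> \<open>Each index is charged to the single point \<open>p i\<close>, so that exchanging
    the two sums leaves every coefficient exactly once.\<close>
  have "(\<Sum>y\<in>p ` I. \<bar>\<Sum>i\<in>I. a i * indicat_real {p i} y\<bar>) \<le>
      (\<Sum>y\<in>p ` I. \<Sum>i\<in>I. if p i = y then \<bar>a i\<bar> else 0)"
    by (intro sum_mono order_trans[OF sum_abs]) (auto simp: abs_mult indicator_def intro!: sum_mono)
  also have "\<dots> = (\<Sum>i\<in>I. \<bar>a i\<bar>)"
    using assms by (subst sum.swap) (auto intro!: sum.cong)
  finally show "nrm (l1_free_space S) (\<lambda>y. \<Sum>i\<in>I. a i * indicat_real {p i} y) \<le> (\<Sum>i\<in>I. \<bar>a i\<bar>)"
    using l1_nrm_eq[OF _ sub] assms by simp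
qed

section \<open>Groupoids and their modules\<close>

context groupoid
begin

text \<open>A right inverse suffices: a two-sided inverse \<open>k\<close> exists, and bracketing
  the product of \<open>k\<close>, \<open>g\<close>, \<open>h\<close> in both ways gives
  \<open>k = h\<close>. Inverses can thus be identified by checking one equation.\<close>

lemma ginv_unique:
  assumes g: "g \<in> mor G" and h: "h \<in> mor G" "src G h = tgt G g" "tgt G h = src G g"
    and gh: "cmp G g h = ident G (tgt G g)"
  shows "ginv G g = h"
proof -
  have *: "k = h" if k: "k \<in> mor G" "src G k = tgt G g" "tgt G k = src G g"
    "cmp G k g = ident G (src G g)" for k
    using cmp_assoc[of k g h] ident_left[of h] ident_right[of k] g h gh k by simp
  obtain k where "k \<in> mor G" "src G k = tgt G g" "tgt G k = src G g"
    "cmp G g k = ident G (tgt G g)" "cmp G k g = ident G (src G g)"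
    using invertible[OF g] by blast
  then show ?thesis unfolding ginv_def by (intro the_equality) (use * in blast)+
qed

lemma
  assumes "g \<in> mor G"
  shows ginv_mor: "ginv G g \<in> mor G"
    and src_ginv: "src G (ginv G g) = tgt G g"
    and tgt_ginv: "tgt G (ginv G g) = src G g"
    and cmp_ginv: "cmp G g (ginv G g) = ident G (tgt G g)"
    and ginv_cmp_self: "cmp G (ginv G g) g = ident G (src G g)"
proof -
  obtain k where "k \<in> mor G" "src G k = tgt G g" "tgt G k = src G g"
    "cmp G g k = ident G (tgt G g)" "cmp G k g = ident G (src G g)"
    using invertible[OF assms] by blast
  moreover from this have "ginv G g = k" by (intro ginv_unique assms)
  ultimately show "ginv G g \<in> mor G" "src G (ginv G g) = tgt G g" "tgt G (ginv G g) = src G g"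
    "cmp G g (ginv G g) = ident G (tgt G g)" "cmp G (ginv G g) g = ident G (src G g)" by auto
qed

lemmas mor_simps = src_ob tgt_ob cmp_mor src_cmp tgt_cmp ident_mor src_ident tgt_ident
  ginv_mor src_ginv tgt_ginv

lemma ginv_ident: "e \<in> ob G \<Longrightarrow> ginv G (ident G e) = ident G e"
  using ident_left[of "ident G e"] by (intro ginv_unique) (simp_all add: mor_simps)

lemma ginv_cancel_left:
  "\<lbrakk>g \<in> mor G; h \<in> mor G; src G g = tgt G h\<rbrakk> \<Longrightarrow> cmp G (ginv G g) (cmp G g h) = h"
  using cmp_assoc[of "ginv G g" g h] by (simp add: mor_simps ginv_cmp_self ident_left)

lemma cmp_ginv_cancel_left:
  "\<lbrakk>g \<in> mor G; h \<in> mor G; tgt G g = tgt G h\<rbrakk> \<Longrightarrow> cmp G g (cmp G (ginv G g) h) = h"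
  using cmp_assoc[of g "ginv G g" h] by (simp add: mor_simps cmp_ginv ident_left)

lemma ginv_cmp:
  assumes "g \<in> mor G" "h \<in> mor G" "src G g = tgt G h"
  shows "ginv G (cmp G g h) = cmp G (ginv G h) (ginv G g)"
  using assms
  by (intro ginv_unique) (simp_all add: mor_simps cmp_assoc cmp_ginv_cancel_left cmp_ginv)

end

context normed_gmodule
begin

lemma act_closed:
  "\<lbrakk>g \<in> mor G; v \<in> carrier (sp V (src G g))\<rbrakk> \<Longrightarrow> act V g v \<in> carrier (sp V (tgt G g))"
  by (rule linear_onD(1)[OF act_linear])

lemma act_ginv_closed:
  "\<lbrakk>g \<in> mor G; v \<in> carrier (sp V (tgt G g))\<rbrakk> \<Longrightarrow> act V (ginv G g) v \<in> carrier (sp V (src G g))"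
  using act_closed[of "ginv G g" v] by (simp add: mor_simps)

lemma act_act_ginv:
  "\<lbrakk>g \<in> mor G; v \<in> carrier (sp V (tgt G g))\<rbrakk> \<Longrightarrow> act V g (act V (ginv G g) v) = v"
  using act_cmp[of g "ginv G g" v] act_ident[of "tgt G g" v] by (simp add: mor_simps cmp_ginv)

lemma act_ginv_act:
  "\<lbrakk>g \<in> mor G; v \<in> carrier (sp V (src G g))\<rbrakk> \<Longrightarrow> act V (ginv G g) (act V g v) = v"
  using act_cmp[of "ginv G g" g v] act_ident[of "src G g" v]
  by (simp add: mor_simps ginv_cmp_self)

lemma nrm_act_ginv:
  "\<lbrakk>g \<in> mor G; v \<in> carrier (sp V (tgt G g))\<rbrakk> \<Longrightarrow>
    nrm (sp V (src G g)) (act V (ginv G g) v) = nrm (sp V (tgt G g)) v"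
  using act_isometry[of "ginv G g" v] by (simp add: mor_simps)

lemma act_ginv_linear:
  "g \<in> mor G \<Longrightarrow> linear_on (sp V (tgt G g)) (sp V (src G g)) (act V (ginv G g))"
  using act_linear[of "ginv G g"] by (simp add: mor_simps)

end

section \<open>Modules of bounded linear maps\<close>

lemma hom_gmodule_simps [simp]:
  "sp (hom_gmodule G V W) e = op_space (sp V e) (sp W e)"
  "act (hom_gmodule G V W) g f =
    (\<lambda>v\<in>carrier (sp V (tgt G g)). act W g (f (act V (ginv G g) v)))"
  by (simp_all add: hom_gmodule_def)

lemma triv_gmodule_simps [simp]: "sp triv_gmodule e = real_space" "act triv_gmodule g r = r"
  by (simp_all add: triv_gmodule_def)

lemma normed_gmodule_triv_gmodule: "groupoid G \<Longrightarrow> normed_gmodule G triv_gmodule"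
  by (intro normed_gmodule.intro normed_gmodule_axioms.intro)
    (auto simp: normed_space_on_real_space intro!: linear_onI)

text \<open>This serves twice: for the dual module, and for the module of bounded linear maps on
  chains whose invariants are the cochains.\<close>

lemma normed_gmodule_hom_gmodule:
  assumes "normed_gmodule G V" "normed_gmodule G W"
  shows "normed_gmodule G (hom_gmodule G V W)"
proof -
  interpret V: normed_gmodule G V by fact
  interpret W: normed_gmodule G W by fact
  let ?H = "hom_gmodule G V W"
  have lin: "linear_on (sp V e) (sp W e) f" if "f \<in> carrier (sp ?H e)" for f e
    using that by (auto dest: bounded_linear_onD)
  note mor_simps = V.mor_simps
  have act_lin: "linear_on (sp V (tgt G g)) (sp W (tgt G g)) (act ?H g f)"
    if g: "g \<in> mor G" and f: "f \<in> carrier (sp ?H (src G g))" for g f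
  proof (rule linear_onI)
    note V = linear_onD[OF V.act_ginv_linear[OF g]]
    note W = linear_onD[OF W.act_linear[OF g]]
    note f = linear_onD[OF lin[OF f]]
    interpret Ve: normed_space_on "sp V (tgt G g)" by (simp add: V.normed mor_simps g)
    fix v r assume v: "v \<in> carrier (sp V (tgt G g))"
    then show "act ?H g f v \<in> carrier (sp W (tgt G g))" by (simp add: V W f)
    show "act ?H g f (r \<odot>\<^bsub>sp V (tgt G g)\<^esub> v) = r \<odot>\<^bsub>sp W (tgt G g)\<^esub> act ?H g f v"
      using v by (simp add: V W f Ve.smult_in)
    fix w assume w: "w \<in> carrier (sp V (tgt G g))"
    show "act ?H g f (v \<oplus>\<^bsub>sp V (tgt G g)\<^esub> w) =
        act ?H g f v \<oplus>\<^bsub>sp W (tgt G g)\<^esub> act ?H g f w"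
      using v w by (simp add: V W f)
  qed
  have nrm_act: "nrm (sp W (tgt G g)) (act ?H g f v) =
      nrm (sp W (src G g)) (f (act V (ginv G g) v))"
    if g: "g \<in> mor G" and f: "f \<in> carrier (sp ?H (src G g))" and v: "v \<in> carrier (sp V (tgt G g))"
    for g f v
    using linear_onD(1)[OF lin[OF f] V.act_ginv_closed[OF g v]] v W.act_isometry[OF g] by simp
  have act_in: "act ?H g f \<in> carrier (sp ?H (tgt G g))"
    if g: "g \<in> mor G" and f: "f \<in> carrier (sp ?H (src G g))" for g f
  proof -
    obtain K where "\<And>v. v \<in> carrier (sp V (src G g)) \<Longrightarrow>
        nrm (sp W (src G g)) (f v) \<le> K * nrm (sp V (src G g)) v"
      using f by (auto simp: bounded_linear_on_def)
    then have "nrm (sp W (tgt G g)) (act ?H g f v) \<le> K * nrm (sp V (tgt G g)) v"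
      if "v \<in> carrier (sp V (tgt G g))" for v
      using that nrm_act[OF g f that] V.act_ginv_closed[OF g that] V.nrm_act_ginv[OF g that] by metis
    then show ?thesis
      using act_lin[OF g f] by (auto simp: bounded_linear_on_def)
  qed
  show ?thesis
  proof (intro normed_gmodule.intro V.groupoid_axioms normed_gmodule_axioms.intro)
    show "normed_space_on (sp ?H e)" if "e \<in> ob G" for e
      using that by (simp add: normed_space_on_op_space V.normed W.normed)
  next
    fix g assume g: "g \<in> mor G"
    note W = linear_onD[OF W.act_linear[OF g]]
    interpret Ve: normed_space_on "sp V (tgt G g)" by (simp add: V.normed mor_simps g)
    show "linear_on (sp ?H (src G g)) (sp ?H (tgt G g)) (act ?H g)"
    proof (rule linear_onI)
      fix f r assume f: "f \<in> carrier (sp ?H (src G g))"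
      show "act ?H g f \<in> carrier (sp ?H (tgt G g))" by (rule act_in[OF g f])
      show "act ?H g (r \<odot>\<^bsub>sp ?H (src G g)\<^esub> f) = r \<odot>\<^bsub>sp ?H (tgt G g)\<^esub> act ?H g f"
        using linear_onD(1)[OF lin[OF f]] by (auto simp: V.act_ginv_closed g W intro!: restrict_ext)
      fix f' assume f': "f' \<in> carrier (sp ?H (src G g))"
      show "act ?H g (f \<oplus>\<^bsub>sp ?H (src G g)\<^esub> f') = act ?H g f \<oplus>\<^bsub>sp ?H (tgt G g)\<^esub> act ?H g f'"
        using linear_onD(1)[OF lin[OF f]] linear_onD(1)[OF lin[OF f']]
        by (auto simp: V.act_ginv_closed g W intro!: restrict_ext)
    qed
    fix f assume f: "f \<in> carrier (sp ?H (src G g))"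
    have "nrm (sp W (tgt G g)) (act ?H g f v) / nrm (sp V (tgt G g)) v =
        nrm (sp W (src G g)) (f (act V (ginv G g) v)) / nrm (sp V (src G g)) (act V (ginv G g) v)"
      if "v \<in> carrier (sp V (tgt G g))" for v
      using nrm_act[OF g f that] V.nrm_act_ginv[OF g that] by simp
    \<comment> \<open>Acting by the inverse preserves norms and maps onto the other carrier, so both
      operator norms are suprema of the same set of quotients.\<close>
    moreover have "act V (ginv G g) ` carrier (sp V (tgt G g)) = carrier (sp V (src G g))"
      using V.act_ginv_closed[OF g] V.act_ginv_act[OF g] V.act_closed[OF g] by force
    ultimately have "(\<lambda>v. nrm (sp W (tgt G g)) (act ?H g f v) / nrm (sp V (tgt G g)) v)
          ` carrier (sp V (tgt G g)) =
        (\<lambda>v. nrm (sp W (src G g)) (f v) / nrm (sp V (src G g)) v) ` carrier (sp V (src G g))"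
      by (metis (no_types, lifting) image_cong image_image)
    then show "nrm (sp ?H (tgt G g)) (act ?H g f) = nrm (sp ?H (src G g)) f"
      by (simp add: op_nrm_def del: hom_gmodule_simps(2))
  next
    fix g h f assume gh: "g \<in> mor G" "h \<in> mor G" "src G g = tgt G h"
      and f: "f \<in> carrier (sp ?H (src G h))"
    have "act V (ginv G (cmp G g h)) v = act V (ginv G h) (act V (ginv G g) v)"
      if "v \<in> carrier (sp V (tgt G g))" for v
      using gh that by (simp add: mor_simps V.ginv_cmp V.act_cmp)
    then show "act ?H g (act ?H h f) = act ?H (cmp G g h) f"
      using gh V.act_ginv_closed[OF gh(1)] V.act_ginv_closed[OF gh(2)] linear_onD(1)[OF lin[OF f]]
      by (auto simp: mor_simps W.act_cmp intro!: restrict_ext)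
  next
    fix e f assume "e \<in> ob G" "f \<in> carrier (sp ?H e)"
    then show "act ?H (ident G e) f = f"
      using linear_onD(1)[OF lin, of f e]
      by (auto simp: mor_simps V.ginv_ident V.act_ident W.act_ident
          intro!: extensionalityI[of _ "carrier (sp V e)"])
  qed
qed

section \<open>Invariants and equivariant families\<close>

lemma invariants_simps [simp]:
  "carrier (invariants G V) = {v \<in> \<Pi>\<^sub>E e\<in>ob G. carrier (sp V e).
     (\<forall>g \<in> mor G. act V g (v (src G g)) = v (tgt G g)) \<and>
     bdd_above ((\<lambda>e. nrm (sp V e) (v e)) ` ob G)}"
  "\<zero>\<^bsub>invariants G V\<^esub> = (\<lambda>e\<in>ob G. \<zero>\<^bsub>sp V e\<^esub>)"
  "v \<oplus>\<^bsub>invariants G V\<^esub> w = (\<lambda>e\<in>ob G. v e \<oplus>\<^bsub>sp V e\<^esub> w e)"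
  "r \<odot>\<^bsub>invariants G V\<^esub> v = (\<lambda>e\<in>ob G. r \<odot>\<^bsub>sp V e\<^esub> v e)"
  by (simp_all add: invariants_def)

text \<open>The operations are fibrewise; invariance is kept because the action is linear,
  boundedness because bounds of two families add up. For cochains this provides the additive group
  of which cohomology is a subquotient.\<close>

lemma abelian_group_invariants:
  assumes "normed_gmodule G V"
  shows "abelian_group (invariants G V)"
proof -
  interpret normed_gmodule G V by fact
  let ?C = "carrier (invariants G V)"
  have ne: "normed_space_on (sp V e)" if "e \<in> ob G" for e using that by (rule normed)
  have ab: "abelian_group (sp V e)" if "e \<in> ob G" for e
    by (rule Module.module.axioms(2)[OF normed_space_on.axioms(1)[OF ne[OF that]]])
  have in_sp: "v e \<in> carrier (sp V e)" if "v \<in> ?C" "e \<in> ob G" for v e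
    using that by (auto simp: PiE_iff)
  have act_zero: "act V g \<zero>\<^bsub>sp V (src G g)\<^esub> = \<zero>\<^bsub>sp V (tgt G g)\<^esub>" if "g \<in> mor G" for g
    using that by (intro linear_on_zero act_linear ne) (auto simp: mor_simps)
  have bdd: "bdd_above ((\<lambda>e. nrm (sp V e) (v e)) ` ob G)"
    if "\<And>e. e \<in> ob G \<Longrightarrow> nrm (sp V e) (v e) \<le> K" for K v
    using that by (rule bdd_aboveI2)
  have zero: "(\<lambda>e\<in>ob G. \<zero>\<^bsub>sp V e\<^esub>) \<in> ?C"
    using ab abelian_groupE(2) normed_space_on.nrm_zero[OF ne]
    by (auto simp: mor_simps act_zero intro!: bdd[of _ 0])
  have add: "(\<lambda>e\<in>ob G. v e \<oplus>\<^bsub>sp V e\<^esub> w e) \<in> ?C" if v: "v \<in> ?C" and w: "w \<in> ?C" for v w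
  proof -
    obtain K L where "\<forall>e\<in>ob G. nrm (sp V e) (v e) \<le> K" "\<forall>e\<in>ob G. nrm (sp V e) (w e) \<le> L"
      using v w by (auto simp: bdd_above_def)
    then have "nrm (sp V e) (v e \<oplus>\<^bsub>sp V e\<^esub> w e) \<le> K + L" if "e \<in> ob G" for e
      using normed_space_on.nrm_triangle[OF ne[OF that] in_sp[OF v that] in_sp[OF w that]] that
      by fastforce
    then have "bdd_above ((\<lambda>e. nrm (sp V e) ((\<lambda>e\<in>ob G. v e \<oplus>\<^bsub>sp V e\<^esub> w e) e)) ` ob G)"
      by (intro bdd[of _ "K + L"]) auto
    moreover have "act V g (v (src G g) \<oplus>\<^bsub>sp V (src G g)\<^esub> w (src G g)) =
        v (tgt G g) \<oplus>\<^bsub>sp V (tgt G g)\<^esub> w (tgt G g)" if "g \<in> mor G" for g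
      using that v w linear_onD(2)[OF act_linear[OF that]] by (auto simp: in_sp[OF v] in_sp[OF w] mor_simps)
    ultimately show ?thesis
      using abelian_groupE(1)[OF ab] in_sp[OF v] in_sp[OF w] by (simp add: mor_simps)
  qed
  have smult: "(\<lambda>e\<in>ob G. r \<odot>\<^bsub>sp V e\<^esub> v e) \<in> ?C" if v: "v \<in> ?C" for v r
  proof -
    obtain K where "\<forall>e\<in>ob G. nrm (sp V e) (v e) \<le> K"
      using v by (auto simp: bdd_above_def)
    then have "nrm (sp V e) (r \<odot>\<^bsub>sp V e\<^esub> v e) \<le> \<bar>r\<bar> * K" if "e \<in> ob G" for e
      using normed_space_on.nrm_smult[OF ne[OF that] in_sp[OF v that]] that
      by (auto intro: mult_left_mono)
    then have "bdd_above ((\<lambda>e. nrm (sp V e) ((\<lambda>e\<in>ob G. r \<odot>\<^bsub>sp V e\<^esub> v e) e)) ` ob G)"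
      by (intro bdd[of _ "\<bar>r\<bar> * K"]) auto
    moreover have "act V g (r \<odot>\<^bsub>sp V (src G g)\<^esub> v (src G g)) = r \<odot>\<^bsub>sp V (tgt G g)\<^esub> v (tgt G g)"
      if "g \<in> mor G" for g
      using that v linear_onD(3)[OF act_linear[OF that]] by (auto simp: in_sp[OF v] mor_simps)
    ultimately show ?thesis
      using normed_space_on.smult_in[OF ne] in_sp[OF v] by (simp add: mor_simps)
  qed
  have eqI: "v = w" if "v \<in> extensional (ob G)" "w \<in> extensional (ob G)" "\<And>e. e \<in> ob G \<Longrightarrow> v e = w e" for v w
    using that by (auto intro: extensionalityI)
  show ?thesis
    unfolding invariants_def
  proof (intro abelian_group_mk_nspaceI; unfold invariants_simps(1)[symmetric])
    fix x assume x: "x \<in> ?C"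
    show "(\<lambda>e\<in>ob G. (\<lambda>e\<in>ob G. \<zero>\<^bsub>sp V e\<^esub>) e \<oplus>\<^bsub>sp V e\<^esub> x e) = x"
      using x by (intro eqI) (auto simp: abelian_groupE(5)[OF ab] in_sp[OF x] PiE_iff)
    show "(\<lambda>e\<in>ob G. (\<lambda>e\<in>ob G. (- 1) \<odot>\<^bsub>sp V e\<^esub> x e) e \<oplus>\<^bsub>sp V e\<^esub> x e) = (\<lambda>e\<in>ob G. \<zero>\<^bsub>sp V e\<^esub>)"
      by (intro eqI) (auto simp: normed_space_on.neg_smult_add[OF ne] in_sp[OF x])
    fix y assume y: "y \<in> ?C"
    show "(\<lambda>e\<in>ob G. x e \<oplus>\<^bsub>sp V e\<^esub> y e) = (\<lambda>e\<in>ob G. y e \<oplus>\<^bsub>sp V e\<^esub> x e)"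
      by (intro eqI) (auto simp: abelian_groupE(4)[OF ab] in_sp[OF x] in_sp[OF y])
    fix w assume w: "w \<in> ?C"
    show "(\<lambda>e\<in>ob G. (\<lambda>e\<in>ob G. x e \<oplus>\<^bsub>sp V e\<^esub> y e) e \<oplus>\<^bsub>sp V e\<^esub> w e) =
        (\<lambda>e\<in>ob G. x e \<oplus>\<^bsub>sp V e\<^esub> (\<lambda>e\<in>ob G. y e \<oplus>\<^bsub>sp V e\<^esub> w e) e)"
      by (intro eqI) (auto simp: abelian_groupE(3)[OF ab] in_sp[OF x] in_sp[OF y] in_sp[OF w])
  qed (fact zero add smult)+
qed

text \<open>Trades the supremum of operator norms for a single constant valid on all fibres, the
  form in which estimates are made. The hypotheses are fibrewise so that the lemma applies to the
  mean, where \<open>linf_gmodule\<close> enters through its normed fibres.\<close>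

lemma gmap_iff_normed:
  assumes V: "\<And>e. e \<in> ob G \<Longrightarrow> normed_space_on (sp V e)"
    and W: "\<And>e. e \<in> ob G \<Longrightarrow> normed_space_on (sp W e)"
  shows "gmap G V W f \<longleftrightarrow>
    (\<forall>e\<in>ob G. linear_on (sp V e) (sp W e) (f e)) \<and>
    (\<forall>g\<in>mor G. \<forall>v\<in>carrier (sp V (src G g)). f (tgt G g) (act V g v) = act W g (f (src G g) v)) \<and>
    (\<exists>K\<ge>0. \<forall>e\<in>ob G. \<forall>v\<in>carrier (sp V e). nrm (sp W e) (f e v) \<le> K * nrm (sp V e) v)"
    (is "_ \<longleftrightarrow> ?lin \<and> ?equi \<and> ?bound")
proof -
  have 1: "?bound" if f: "gmap G V W f"
  proof -
    obtain K where K: "\<forall>e\<in>ob G. op_nrm (sp V e) (sp W e) (f e) \<le> K"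
      using f by (auto simp: gmap_def bdd_above_def)
    \<comment> \<open>An upper bound of the family of operator norms has no sign if there are no
      objects, hence \<open>max K 0\<close>.\<close>
    have "nrm (sp W e) (f e v) \<le> max K 0 * nrm (sp V e) v" if e: "e \<in> ob G" "v \<in> carrier (sp V e)" for e v
    proof -
      have "nrm (sp W e) (f e v) \<le> op_nrm (sp V e) (sp W e) (f e) * nrm (sp V e) v"
        using f e by (intro nrm_le_op_nrm V W) (auto simp: gmap_def)
      also have "\<dots> \<le> max K 0 * nrm (sp V e) v"
        using K e(1) normed_space_on.nrm_nonneg[OF V[OF e(1)] e(2)] by (intro mult_right_mono) auto
      finally show ?thesis .
    qed
    then show ?bound by (intro exI[of _ "max K 0"]) auto
  qed
  have 2: "bdd_above ((\<lambda>e. op_nrm (sp V e) (sp W e) (f e)) ` ob G)" if ?bound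
  proof -
    obtain K where "0 \<le> K" "\<forall>e\<in>ob G. \<forall>v\<in>carrier (sp V e). nrm (sp W e) (f e v) \<le> K * nrm (sp V e) v"
      using \<open>?bound\<close> by auto
    then show ?thesis by (intro bdd_aboveI2[of _ _ K] op_nrm_le V) auto
  qed
  show ?thesis
  proof
    assume f: "gmap G V W f"
    with 1 show "?lin \<and> ?equi \<and> ?bound" by (auto simp: gmap_def bounded_linear_on_def)
  next
    assume f: "?lin \<and> ?equi \<and> ?bound"
    have "bounded_linear_on (sp V e) (sp W e) (f e)" if "e \<in> ob G" for e
      using f that unfolding bounded_linear_on_def by meson
    then show "gmap G V W f" using f 2 by (simp add: gmap_def)
  qed
qed

lemma gmap_iff:
  assumes "normed_gmodule G V" "normed_gmodule G W"
  shows "gmap G V W f \<longleftrightarrow>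
    (\<forall>e\<in>ob G. linear_on (sp V e) (sp W e) (f e)) \<and>
    (\<forall>g\<in>mor G. \<forall>v\<in>carrier (sp V (src G g)). f (tgt G g) (act V g v) = act W g (f (src G g) v)) \<and>
    (\<exists>K\<ge>0. \<forall>e\<in>ob G. \<forall>v\<in>carrier (sp V e). nrm (sp W e) (f e v) \<le> K * nrm (sp V e) v)"
  using assms by (intro gmap_iff_normed normed_gmodule.normed)

lemma gmap_comp:
  assumes "normed_gmodule G U" "normed_gmodule G V" "normed_gmodule G W"
    and f: "gmap G U V f" and h: "gmap G V W h"
  shows "gmap G U W (\<lambda>e u. h e (f e u))"
proof -
  interpret U: normed_gmodule G U by fact
  note fI = f[unfolded gmap_iff[OF assms(1,2)]] and hI = h[unfolded gmap_iff[OF assms(2,3)]]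
  obtain K L where K: "0 \<le> K" "\<And>e u. \<lbrakk>e \<in> ob G; u \<in> carrier (sp U e)\<rbrakk> \<Longrightarrow>
      nrm (sp V e) (f e u) \<le> K * nrm (sp U e) u"
    and L: "0 \<le> L" "\<And>e v. \<lbrakk>e \<in> ob G; v \<in> carrier (sp V e)\<rbrakk> \<Longrightarrow>
      nrm (sp W e) (h e v) \<le> L * nrm (sp V e) v"
    using fI hI by metis
  have lin: "linear_on (sp U e) (sp V e) (f e)" "linear_on (sp V e) (sp W e) (h e)" if "e \<in> ob G" for e
    using fI hI that by auto
  have "nrm (sp W e) (h e (f e u)) \<le> L * K * nrm (sp U e) u" if "e \<in> ob G" "u \<in> carrier (sp U e)" for e u
    using L(2)[OF that(1) linear_onD(1)[OF lin(1)[OF that(1)] that(2)]]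
      mult_left_mono[OF K(2)[OF that] L(1)]
    by simp
  moreover have "linear_on (sp U e) (sp W e) (\<lambda>u. h e (f e u))" if "e \<in> ob G" for e
    using linear_onD[OF lin(1)[OF that]] linear_onD[OF lin(2)[OF that]] by (intro linear_onI) auto
  moreover have "h (tgt G g) (f (tgt G g) (act U g u)) = act W g (h (src G g) (f (src G g) u))"
    if "g \<in> mor G" "u \<in> carrier (sp U (src G g))" for g u
    using fI hI that linear_onD(1)[OF lin(1)] by (simp add: U.mor_simps)
  ultimately show ?thesis
    unfolding gmap_iff[OF assms(1,3)] using K(1) L(1) by (auto intro!: exI[of _ "L * K"])
qed

text \<open>Being a \<open>gmap\<close> depends only on values at objects and carrier elements. A
  cochain can therefore be given by an unrestricted formula and made extensional at the end.\<close>

lemma gmap_restrict: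
  assumes "normed_gmodule G V" "normed_gmodule G W" and f: "gmap G V W f"
  shows "gmap G V W (\<lambda>e\<in>ob G. \<lambda>v\<in>carrier (sp V e). f e v)"
proof -
  interpret V: normed_gmodule G V by fact
  interpret W: normed_gmodule G W by fact
  note fI = f[unfolded gmap_iff[OF assms(1,2)]]
  have "linear_on (sp V e) (sp W e) (\<lambda>v\<in>carrier (sp V e). f e v)" if e: "e \<in> ob G" for e
  proof -
    interpret Ve: normed_space_on "sp V e" by (rule V.normed[OF e])
    have "linear_on (sp V e) (sp W e) (f e)" using fI e by auto
    note lin = linear_onD[OF this]
    show ?thesis by (intro linear_onI) (simp_all add: lin Ve.smult_in)
  qed
  then show ?thesis
    unfolding gmap_iff[OF assms(1,2)] using fI by (simp add: V.mor_simps V.act_closed)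
qed

text \<open>Invariance under the conjugation action turns into equivariance by substituting
  \<open>act V g v\<close> for \<open>v\<close>. Cochains can from here on be treated as extensional
  equivariant families.\<close>

lemma carrier_BG:
  assumes "normed_gmodule G V" "normed_gmodule G W"
  shows "f \<in> carrier (BG G V W) \<longleftrightarrow>
    f \<in> extensional (ob G) \<and> (\<forall>e\<in>ob G. f e \<in> extensional (carrier (sp V e))) \<and> gmap G V W f"
proof -
  interpret V: normed_gmodule G V by fact
  interpret W: normed_gmodule G W by fact
  have "(act (hom_gmodule G V W) g (f (src G g)) = f (tgt G g)) \<longleftrightarrow>
    (\<forall>v\<in>carrier (sp V (src G g)). f (tgt G g) (act V g v) = act W g (f (src G g) v))"
    if g: "g \<in> mor G" and ext: "\<forall>e\<in>ob G. f e \<in> extensional (carrier (sp V e))" for g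
  proof -
    have "(act (hom_gmodule G V W) g (f (src G g)) = f (tgt G g)) \<longleftrightarrow>
      (\<forall>v\<in>carrier (sp V (tgt G g)). act W g (f (src G g) (act V (ginv G g) v)) = f (tgt G g) v)"
      using ext g by (auto simp: fun_eq_iff V.mor_simps extensional_def)
    also have "\<dots> \<longleftrightarrow> (\<forall>v\<in>carrier (sp V (src G g)). f (tgt G g) (act V g v) = act W g (f (src G g) v))"
      using V.act_closed[OF g] V.act_ginv_closed[OF g] V.act_act_ginv[OF g] V.act_ginv_act[OF g] by metis
    finally show ?thesis .
  qed
  then show ?thesis
    by (auto simp: BG_def gmap_def PiE_iff simp del: hom_gmodule_simps(2))
qed

section \<open>The bar complex and its contracting homotopy\<close>

definition left_mult :: "('o, 'g) groupoid \<Rightarrow> 'g \<Rightarrow> 'g list \<Rightarrow> 'g list" where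
  "left_mult G g x = cmp G g (hd x) # tl x"

text \<open>Joins the inner faces and the last one under one index, so that the boundary is a single
  alternating sum over \<open>i \<le> n\<close>. Every index from \<open>n\<close> on gives the last
  face.\<close>

definition face :: "('o, 'g) groupoid \<Rightarrow> nat \<Rightarrow> nat \<Rightarrow> 'g list \<Rightarrow> 'g list" where
  "face G n i x = (if i < n then merge G i x else butlast x)"

text \<open>In the homogeneous coordinates \<open>(g\<^sub>0, g\<^sub>0 g\<^sub>1, \<dots>)\<close> of a path, \<open>cone G h\<close> prepends \<open>h\<close>.
  The clause for the empty list makes the homotopy identity hold in degree 0 as well, where
  \<open>boundary G 0\<close> is the augmentation with basis vector \<open>[]\<close> in degree \<open>-1\<close>.\<close>

fun cone :: "('o, 'g) groupoid \<Rightarrow> 'g \<Rightarrow> 'g list \<Rightarrow> 'g list" where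
  "cone G h [] = [h]"
| "cone G h (g # x) = h # cmp G (ginv G h) g # x"

abbreviation cone_ext :: "('o, 'g) groupoid \<Rightarrow> 'g \<Rightarrow> ('g list \<Rightarrow> real) \<Rightarrow> 'g list \<Rightarrow> real" where
  "cone_ext G h \<equiv> lin_ext (\<lambda>x. indicat_real {cone G h x})"

lemma chain_gmodule_simps [simp]:
  "sp (chain_gmodule G n) e = l1_free_space (paths G n e)"
  "act (chain_gmodule G n) g = lin_ext (\<lambda>x. indicat_real {left_mult G g x})"
  by (simp_all add: chain_gmodule_def left_mult_def)

lemma left_mult_Cons [simp]: "left_mult G g (h # x) = cmp G g h # x"
  by (simp add: left_mult_def)

lemma merge_simps [simp]:
  "merge G 0 (g # h # x) = cmp G g h # x"
  "merge G (Suc i) (g # x) = g # merge G i x"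
  by (simp_all add: merge_def numeral_2_eq_2)

text \<open>A recursion along the path: index 0 acts at the head, a positive index on the tail. The
  tail has to be nonempty in the second equation because \<open>butlast\<close> turns a one-element
  list into \<open>[]\<close> and loses the head.\<close>

lemma face_simps [simp]:
  "face G (Suc n) 0 (g # h # x) = cmp G g h # x"
  "x \<noteq> [] \<Longrightarrow> face G (Suc n) (Suc i) (g # x) = g # face G n i x"
  "face G 0 i x = butlast x"
  by (simp_all add: face_def)

lemma boundary_eq:
  "boundary G n = lin_ext (\<lambda>x y. \<Sum>i\<le>n. (- 1) ^ i * indicat_real {face G n i x} y)"
proof -
  have "{..n} = insert n {..<n}" by auto
  then show ?thesis by (simp add: boundary_def face_def fun_eq_iff add.commute)
qed

lemma boundary_indicator:
  "boundary G n (indicat_real {x}) = (\<lambda>y. \<Sum>i\<le>n. (- 1) ^ i * indicat_real {face G n i x} y)"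
  by (simp add: boundary_eq)

lemma Cons_in_paths_0 [simp]: "g # x \<in> paths G 0 e \<longleftrightarrow> g \<in> mor G \<and> tgt G g = e \<and> x = []"
  by (auto simp: paths_def)

lemma Cons_in_paths_Suc [simp]:
  "g # x \<in> paths G (Suc n) e \<longleftrightarrow> g \<in> mor G \<and> tgt G g = e \<and> x \<in> paths G n (src G g)"
  by (auto simp: paths_def less_Suc_eq_0_disj)

lemma Nil_notin_paths [simp]: "[] \<notin> paths G n e"
  by (simp add: paths_def)

lemma paths_0E:
  assumes "x \<in> paths G 0 e"
  obtains g where "x = [g]" "g \<in> mor G" "tgt G g = e"
  using assms by (cases x) auto

lemma paths_SucE:
  assumes "x \<in> paths G (Suc n) e"
  obtains g h y where "x = g # h # y" "g \<in> mor G" "tgt G g = e" "h # y \<in> paths G n (src G g)"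
    "h \<in> mor G" "tgt G h = src G g"
proof -
  obtain g z where x: "x = g # z" using assms by (cases x) auto
  moreover obtain h y where "z = h # y" using assms x by (cases z) auto
  moreover have "h \<in> mor G \<and> tgt G h = src G g"
    using assms x \<open>z = h # y\<close> by (cases n) auto
  ultimately show thesis using assms that by auto
qed

lemma pathsE:
  assumes "x \<in> paths G n e"
  obtains g y where "x = g # y" "g \<in> mor G" "tgt G g = e"
  using assms by (cases n) (auto elim: paths_0E paths_SucE)

section \<open>Faces, left multiplication and cones of paths\<close>

context groupoid
begin

text \<open>The head is tied to the rest of the path only through its source. Left multiplication
  and the cone both change the head in this way.\<close>

lemma replace_head_in_paths:
  assumes "g # x \<in> paths G n e" "h \<in> mor G" "src G h = src G g"
  shows "h # x \<in> paths G n (tgt G h)"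
  using assms by (cases n) auto

lemma left_mult_in_paths:
  assumes "g \<in> mor G" "x \<in> paths G n (src G g)"
  shows "left_mult G g x \<in> paths G n (tgt G g)"
proof -
  obtain k y where x: "x = k # y" "k \<in> mor G" "tgt G k = src G g" using assms(2) by (rule pathsE)
  then show ?thesis
    using replace_head_in_paths[of k y n "src G g" "cmp G g k"] assms by (simp add: mor_simps)
qed

lemma face_in_paths: "x \<in> paths G (Suc n) e \<Longrightarrow> face G (Suc n) i x \<in> paths G n e"
proof (induction n arbitrary: x e i)
  case 0
  then obtain g h where "x = [g, h]" "g \<in> mor G" "tgt G g = e" "h \<in> mor G" "tgt G h = src G g"
    by (elim paths_SucE) auto
  then show ?case by (cases i) (auto simp: mor_simps)
next
  case (Suc n)
  from Suc.prems obtain g h y where x: "x = g # h # y" "g \<in> mor G" "tgt G g = e"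
    "h # y \<in> paths G (Suc n) (src G g)" "h \<in> mor G" "tgt G h = src G g"
    by (rule paths_SucE)
  show ?case
  proof (cases i)
    case 0
    then show ?thesis using x by (simp add: mor_simps)
  next
    case (Suc j)
    then show ?thesis using x Suc.IH[of "h # y" "src G g" j] by simp
  qed
qed

text \<open>Only the face of index 0 composes the changed entry with its neighbour, and there the
  claim is associativity.\<close>

lemma left_mult_face:
  assumes "g \<in> mor G" "x \<in> paths G (Suc n) (src G g)"
  shows "face G (Suc n) i (left_mult G g x) = left_mult G g (face G (Suc n) i x)"
proof -
  obtain k h y where "x = k # h # y" "k \<in> mor G" "tgt G k = src G g" "h \<in> mor G" "tgt G h = src G k"
    using assms(2) by (rule paths_SucE)
  then show ?thesis using assms(1) by (cases i) (auto simp: cmp_assoc)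
qed

lemma left_mult_left_mult:
  assumes "g \<in> mor G" "h \<in> mor G" "src G g = tgt G h" "x \<in> paths G n (src G h)"
  shows "left_mult G g (left_mult G h x) = left_mult G (cmp G g h) x"
  using assms by (auto elim!: pathsE simp: cmp_assoc)

lemma left_mult_ident: "x \<in> paths G n e \<Longrightarrow> left_mult G (ident G e) x = x"
  by (auto elim!: pathsE simp: ident_left)

lemma cone_in_paths:
  assumes "h \<in> fibre G e" "x \<in> paths G n e"
  shows "cone G h x \<in> paths G (Suc n) e"
proof -
  obtain k y where x: "x = k # y" "k \<in> mor G" "tgt G k = e" using assms(2) by (rule pathsE)
  then show ?thesis
    using replace_head_in_paths[of k y n e "cmp G (ginv G h) k"] assms by (auto simp: fibre_def mor_simps)
qed

text \<open>The apex becomes \<open>gh\<close>, while the second entry is unchanged because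
  \<open>(gh)^-1 (gk) = h^-1 k\<close>.\<close>

lemma left_mult_cone:
  assumes "g \<in> mor G" "h \<in> fibre G (src G g)" "x \<in> paths G n (src G g)"
  shows "left_mult G g (cone G h x) = cone G (cmp G g h) (left_mult G g x)"
proof -
  obtain k y where "x = k # y" "k \<in> mor G" "tgt G k = src G g" using assms(3) by (rule pathsE)
  then show ?thesis
    using assms(1,2) by (simp add: fibre_def ginv_cmp cmp_assoc mor_simps ginv_cancel_left)
qed

lemma face_0_cone:
  assumes "h \<in> fibre G e" "x \<in> paths G n e"
  shows "face G (Suc n) 0 (cone G h x) = x"
  using assms by (auto elim!: pathsE simp: fibre_def cmp_ginv_cancel_left)

text \<open>A face of positive index leaves the apex alone. For \<open>n = 0\<close> the face of
  \<open>[k]\<close> is \<open>[]\<close>, and its cone \<open>[h]\<close> is the last face of the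
  cone on \<open>[k]\<close>.\<close>

lemma face_Suc_cone:
  assumes "h \<in> fibre G e" "x \<in> paths G n e"
  shows "face G (Suc n) (Suc i) (cone G h x) = cone G h (face G n i x)"
proof (cases n)
  case 0
  then show ?thesis using assms by (auto elim!: paths_0E)
next
  case (Suc m)
  then obtain g k y where "x = g # k # y" "g \<in> mor G" "tgt G g = e" "k \<in> mor G" "tgt G k = src G g"
    using assms by (auto elim!: paths_SucE)
  then show ?thesis
    using assms(1) Suc by (cases i) (auto simp: fibre_def cmp_assoc mor_simps)
qed

section \<open>The homotopy identity and the vanishing of the squared boundary\<close>

lemma boundary_cone_ext_indicator:
  assumes "h \<in> fibre G e" "x \<in> paths G n e"
  shows "boundary G (Suc n) (indicat_real {cone G h x}) y +
    cone_ext G h (boundary G n (indicat_real {x})) y = indicat_real {x} y"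
proof -
  have "cone_ext G h (boundary G n (indicat_real {x})) y =
      (\<Sum>i\<le>n. (- 1) ^ i * indicat_real {cone G h (face G n i x)} y)"
    unfolding boundary_indicator by (subst lin_ext_sum) simp_all
  \<comment> \<open>The index 0 split off from the first sum contributes \<open>x\<close>. The
    remaining faces are cones on the faces of \<open>x\<close> and cancel the second sum, since the
    index shift reverses their sign.\<close>
  then show ?thesis
    unfolding boundary_indicator
    by (simp add: sum.atMost_Suc_shift face_0_cone[OF assms] face_Suc_cone[OF assms] sum_negf
        del: sum.atMost_Suc)
qed

lemma finite_support_boundary: "finite {y. boundary G n (indicat_real {x}) y \<noteq> 0}"
  using sum_indicator_closed[of "{..n}" "\<lambda>i. face G n i x" UNIV "\<lambda>i. (- 1) ^ i"]
  by (simp add: boundary_indicator)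

lemma boundary_as_lin_ext: "boundary G n = lin_ext (\<lambda>x. boundary G n (indicat_real {x}))"
  by (simp add: boundary_eq)

lemma lin_ext_boundary:
  assumes "finite {x. c x \<noteq> 0}"
  shows "lin_ext \<phi> (boundary G n c) = lin_ext (\<lambda>x. lin_ext \<phi> (boundary G n (indicat_real {x}))) c"
  using lin_ext_lin_ext[OF assms finite_support_boundary[of n], of \<phi> "\<lambda>x. x"] by (simp flip: boundary_as_lin_ext)

lemma boundary_cone_ext:
  assumes "h \<in> fibre G e" "c \<in> carrier (l1_free_space (paths G n e))"
  shows "boundary G (Suc n) (cone_ext G h c) y + cone_ext G h (boundary G n c) y = c y"
proof -
  have c: "finite {x. c x \<noteq> 0}" "\<And>x. c x \<noteq> 0 \<Longrightarrow> x \<in> paths G n e" using assms(2) by auto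
  have "boundary G (Suc n) (cone_ext G h c) =
      lin_ext (\<lambda>x. boundary G (Suc n) (indicat_real {cone G h x})) c"
    unfolding boundary_eq[of G "Suc n"] using c(1) by (intro lin_ext_lin_ext) auto
  moreover have "cone_ext G h (boundary G n c) =
      lin_ext (\<lambda>x. cone_ext G h (boundary G n (indicat_real {x}))) c"
    by (rule lin_ext_boundary[OF c(1)])
  moreover have "lin_ext (\<lambda>x y. boundary G (Suc n) (indicat_real {cone G h x}) y +
      cone_ext G h (boundary G n (indicat_real {x})) y) c = lin_ext (\<lambda>x. indicat_real {x}) c"
    by (intro lin_ext_cong ext boundary_cone_ext_indicator[OF assms(1) c(2)])
  ultimately show ?thesis
    by (simp add: lin_ext_add_fun lin_ext_id[OF c(1)] fun_eq_iff)
qed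

text \<open>The constant counts faces: a path of degree \<open>n + 1\<close> has
  \<open>n + 2\<close> of them, each with coefficient 1 or -1.\<close>

lemma
  assumes "x \<in> paths G (Suc n) e"
  shows boundary_indicator_closed:
      "boundary G (Suc n) (indicat_real {x}) \<in> carrier (l1_free_space (paths G n e))"
    and nrm_boundary_indicator_le:
      "nrm (l1_free_space (paths G n e)) (boundary G (Suc n) (indicat_real {x})) \<le> real n + 2"
  using sum_indicator_closed[of "{..Suc n}" "\<lambda>i. face G (Suc n) i x" "paths G n e" "\<lambda>i. (- 1) ^ i"]
    nrm_sum_indicator_le[of "{..Suc n}" "\<lambda>i. face G (Suc n) i x" "paths G n e" "\<lambda>i. (- 1) ^ i"]
    face_in_paths[OF assms] unfolding boundary_indicator
  by (simp_all del: l1_free_space_simps sum.atMost_Suc)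

lemma boundary_closed:
  "c \<in> carrier (l1_free_space (paths G (Suc n) e)) \<Longrightarrow>
    boundary G (Suc n) c \<in> carrier (l1_free_space (paths G n e))"
  by (subst boundary_as_lin_ext) (rule lin_ext_closed, assumption, rule boundary_indicator_closed)

lemma boundary_boundary_indicator:
  "x \<in> paths G (Suc n) e \<Longrightarrow> boundary G n (boundary G (Suc n) (indicat_real {x})) = (\<lambda>y. 0)"
proof (induction n arbitrary: x e)
  case 0
  then obtain g h where "x = [g, h]" by (elim paths_SucE) auto
  \<comment> \<open>Here \<open>boundary G 0\<close> is the augmentation: the two faces of
    \<open>[g, h]\<close> both go to \<open>[]\<close>, with opposite signs.\<close>
  then show ?case
    by (subst boundary_indicator, subst boundary_eq, subst lin_ext_sum) auto
next
  case (Suc n)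
  from Suc.prems obtain g h y where x: "x = g # h # y" "g \<in> mor G" "tgt G g = e"
    "h \<in> mor G" "tgt G h = src G g"
    by (rule paths_SucE)
  \<comment> \<open>Every path of positive length is a cone, so the claim reduces to the homotopy identity.\<close>
  define z where "z = cmp G g h # y"
  have g: "g \<in> fibre G e" using x by (simp add: fibre_def)
  have z: "z \<in> paths G (Suc n) e" using face_in_paths[OF Suc.prems, of 0] x by (simp add: z_def)
  have cone: "cone G g z = x" using x by (simp add: z_def ginv_cancel_left)
  let ?d = "boundary G (Suc n) (indicat_real {z})"
  have d: "?d \<in> carrier (l1_free_space (paths G n e))" by (rule boundary_indicator_closed[OF z])
  \<comment> \<open>The homotopy identity for \<open>z\<close> gives \<open>1\<close>. Applied to
    the chain \<open>?d\<close> it gives \<open>2\<close>, since \<open>?d\<close> has zero boundary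
    by the induction hypothesis. Together they yield \<open>?d - ?d\<close>.\<close>
  have 1: "boundary G (Suc (Suc n)) (indicat_real {x}) = (\<lambda>y. indicat_real {z} y - cone_ext G g ?d y)"
    using boundary_cone_ext_indicator[OF g z] by (simp add: cone fun_eq_iff algebra_simps)
  have 2: "boundary G (Suc n) (cone_ext G g ?d) = ?d"
    using boundary_cone_ext[OF g d] by (simp add: Suc.IH[OF z] fun_eq_iff)
  have "cone_ext G g ?d \<in> carrier (l1_free_space (paths G (Suc n) e))"
    using d by (rule lin_ext_closed) (simp add: cone_in_paths[OF g] del: l1_free_space_simps)
  then have "boundary G (Suc n) (\<lambda>y. indicat_real {z} y - cone_ext G g ?d y) =
      (\<lambda>y. ?d y - boundary G (Suc n) (cone_ext G g ?d) y)"
    unfolding boundary_eq[of G "Suc n"] by (subst lin_ext_diff) auto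
  then show ?case unfolding 1 2 by simp
qed

lemma boundary_boundary:
  assumes "c \<in> carrier (l1_free_space (paths G (Suc n) e))"
  shows "boundary G n (boundary G (Suc n) c) = (\<lambda>y. 0)"
proof -
  have c: "finite {x. c x \<noteq> 0}" "\<And>x. c x \<noteq> 0 \<Longrightarrow> x \<in> paths G (Suc n) e" using assms by auto
  have "boundary G n (boundary G (Suc n) c) =
      lin_ext (\<lambda>x. boundary G n (boundary G (Suc n) (indicat_real {x}))) c"
    unfolding boundary_eq[of G n] by (rule lin_ext_boundary[OF c(1)])
  also have "\<dots> = lin_ext (\<lambda>x y. 0) c"
    by (intro lin_ext_cong) (auto intro: boundary_boundary_indicator c(2))
  finally show ?thesis by (simp add: lin_ext_def)
qed

section \<open>The chain modules and their equivariant boundary\<close>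

lemma lin_ext_left_mult_closed:
  "\<lbrakk>g \<in> mor G; c \<in> carrier (l1_free_space (paths G n (src G g)))\<rbrakk> \<Longrightarrow>
    lin_ext (\<lambda>x. indicat_real {left_mult G g x}) c \<in> carrier (l1_free_space (paths G n (tgt G g)))"
  by (erule lin_ext_closed) (simp add: left_mult_in_paths del: l1_free_space_simps)

lemma act_chain_cmp:
  assumes "g \<in> mor G" "h \<in> mor G" "src G g = tgt G h"
    and c: "c \<in> carrier (l1_free_space (paths G n (src G h)))"
  shows "act (chain_gmodule G n) g (act (chain_gmodule G n) h c) =
    act (chain_gmodule G n) (cmp G g h) c"
proof -
  have "lin_ext (\<lambda>x. indicat_real {left_mult G g x}) (lin_ext (\<lambda>x. indicat_real {left_mult G h x}) c) =
      lin_ext (\<lambda>x. indicat_real {left_mult G g (left_mult G h x)}) c"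
    using c by (subst lin_ext_lin_ext) auto
  also have "\<dots> = lin_ext (\<lambda>x. indicat_real {left_mult G (cmp G g h) x}) c"
    using c by (intro lin_ext_cong) (auto simp: left_mult_left_mult[OF assms(1-3)])
  finally show ?thesis by simp
qed

lemma act_chain_ident:
  assumes c: "c \<in> carrier (l1_free_space (paths G n e))"
  shows "act (chain_gmodule G n) (ident G e) c = c"
proof -
  have "lin_ext (\<lambda>x. indicat_real {left_mult G (ident G e) x}) c = lin_ext (\<lambda>x. indicat_real {x}) c"
    using c by (intro lin_ext_cong) (auto simp: left_mult_ident)
  then show ?thesis using c by (simp add: lin_ext_id)
qed

text \<open>Basis vectors go to basis vectors, so the constant is 1. The isometry property is then
  obtained by applying the estimate to \<open>g\<close> and to its inverse.\<close>

lemma nrm_act_chain_le: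
  assumes "g \<in> mor G" "c \<in> carrier (l1_free_space (paths G n (src G g)))"
  shows "nrm (l1_free_space (paths G n (tgt G g))) (act (chain_gmodule G n) g c) \<le>
    nrm (l1_free_space (paths G n (src G g))) c"
proof -
  have "nrm (l1_free_space (paths G n (tgt G g))) (act (chain_gmodule G n) g c) \<le>
      1 * nrm (l1_free_space (paths G n (src G g))) c"
    unfolding chain_gmodule_simps using assms(2)
  proof (rule nrm_lin_ext_le)
    fix x assume "x \<in> paths G n (src G g)"
    then show "indicat_real {left_mult G g x} \<in> carrier (l1_free_space (paths G n (tgt G g)))"
      by (simp add: left_mult_in_paths[OF assms(1)] del: l1_free_space_simps)
  qed (simp add: nrm_indicator del: l1_free_space_simps)
  then show ?thesis by simp
qed

lemma normed_gmodule_chain_gmodule: "normed_gmodule G (chain_gmodule G n)"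
proof (intro normed_gmodule.intro groupoid_axioms normed_gmodule_axioms.intro)
  show "normed_space_on (sp (chain_gmodule G n) e)" for e
    by (simp add: normed_space_on_l1_free_space)
next
  fix g assume g: "g \<in> mor G"
  show "linear_on (sp (chain_gmodule G n) (src G g)) (sp (chain_gmodule G n) (tgt G g))
      (act (chain_gmodule G n) g)"
    unfolding chain_gmodule_simps
    by (intro linear_on_lin_ext) (simp add: left_mult_in_paths[OF g] del: l1_free_space_simps)
  fix c assume c: "c \<in> carrier (sp (chain_gmodule G n) (src G g))"
  let ?gc = "act (chain_gmodule G n) g c"
  have gc: "?gc \<in> carrier (l1_free_space (paths G n (tgt G g)))"
    using lin_ext_left_mult_closed[OF g, of c n] c by (simp del: l1_free_space_simps)
  \<comment> \<open>Neither \<open>g\<close> nor its inverse increases norms, and the inverse leads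
    back to \<open>c\<close>; hence the norms are equal.\<close>
  have "act (chain_gmodule G n) (ginv G g) ?gc = c"
    using act_chain_cmp[of "ginv G g" g c n] act_chain_ident[of c n "src G g"] g c
    by (simp add: mor_simps ginv_cmp_self del: l1_free_space_simps chain_gmodule_simps(2))
  then show "nrm (sp (chain_gmodule G n) (tgt G g)) ?gc = nrm (sp (chain_gmodule G n) (src G g)) c"
    using nrm_act_chain_le[OF g, of c n] nrm_act_chain_le[of "ginv G g" ?gc n] g c gc
    by (simp add: mor_simps del: l1_free_space_simps chain_gmodule_simps(2))
qed (simp_all add: act_chain_cmp act_chain_ident del: l1_free_space_simps chain_gmodule_simps(2))

lemma gmap_boundary: "gmap G (chain_gmodule G (Suc n)) (chain_gmodule G n) (\<lambda>e. boundary G (Suc n))"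
  unfolding gmap_iff[OF normed_gmodule_chain_gmodule normed_gmodule_chain_gmodule] chain_gmodule_simps
proof (intro conjI ballI exI[of _ "real n + 2"])
  fix e assume "e \<in> ob G"
  show "linear_on (l1_free_space (paths G (Suc n) e)) (l1_free_space (paths G n e)) (boundary G (Suc n))"
    by (subst boundary_as_lin_ext) (intro linear_on_lin_ext boundary_indicator_closed)
  fix c assume "c \<in> carrier (l1_free_space (paths G (Suc n) e))"
  then show "nrm (l1_free_space (paths G n e)) (boundary G (Suc n) c) \<le>
      (real n + 2) * nrm (l1_free_space (paths G (Suc n) e)) c"
    by (subst boundary_as_lin_ext)
      (intro nrm_lin_ext_le boundary_indicator_closed nrm_boundary_indicator_le)
next
  fix g c assume g: "g \<in> mor G" and c: "c \<in> carrier (l1_free_space (paths G (Suc n) (src G g)))"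
  let ?L = "lin_ext (\<lambda>x. indicat_real {left_mult G g x})"
  have "boundary G (Suc n) (?L c) = lin_ext (\<lambda>x. boundary G (Suc n) (indicat_real {left_mult G g x})) c"
    unfolding boundary_eq[of G "Suc n"] using c by (intro lin_ext_lin_ext) auto
  also have "\<dots> = lin_ext (\<lambda>x. ?L (boundary G (Suc n) (indicat_real {x}))) c"
  proof (rule lin_ext_cong)
    fix x assume "c x \<noteq> 0"
    then have x: "x \<in> paths G (Suc n) (src G g)" using c by auto
    show "boundary G (Suc n) (indicat_real {left_mult G g x}) = ?L (boundary G (Suc n) (indicat_real {x}))"
      unfolding boundary_indicator
      by (subst lin_ext_sum) (simp_all add: left_mult_face[OF g x])
  qed
  also have "\<dots> = ?L (boundary G (Suc n) c)"
    using c by (intro lin_ext_boundary[symmetric]) auto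
  finally show "boundary G (Suc n) (?L c) = ?L (boundary G (Suc n) c)" .
qed simp

text \<open>The bound is uniform in the apex \<open>h\<close>. This is what makes the cochain values
  on cones a bounded function of \<open>h\<close>, to which the mean can be applied.\<close>

lemma
  assumes "h \<in> fibre G e"
  shows linear_on_cone_ext:
      "linear_on (l1_free_space (paths G n e)) (l1_free_space (paths G (Suc n) e)) (cone_ext G h)"
    and nrm_cone_ext_le: "c \<in> carrier (l1_free_space (paths G n e)) \<Longrightarrow>
      nrm (l1_free_space (paths G (Suc n) e)) (cone_ext G h c) \<le> nrm (l1_free_space (paths G n e)) c"
proof -
  have *: "indicat_real {cone G h x} \<in> carrier (l1_free_space (paths G (Suc n) e))"
    if "x \<in> paths G n e" for x
    using that by (simp add: cone_in_paths[OF assms] del: l1_free_space_simps)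
  then show "linear_on (l1_free_space (paths G n e)) (l1_free_space (paths G (Suc n) e)) (cone_ext G h)"
    by (rule linear_on_lin_ext)
  assume "c \<in> carrier (l1_free_space (paths G n e))"
  from nrm_lin_ext_le[OF this *, where K = 1]
  show "nrm (l1_free_space (paths G (Suc n) e)) (cone_ext G h c) \<le> nrm (l1_free_space (paths G n e)) c"
    by (simp add: nrm_indicator del: l1_free_space_simps)
qed

lemma act_cone_ext:
  assumes g: "g \<in> mor G" and h: "h \<in> fibre G (src G g)"
    and c: "c \<in> carrier (l1_free_space (paths G n (src G g)))"
  shows "act (chain_gmodule G (Suc n)) g (cone_ext G h c) =
    cone_ext G (cmp G g h) (act (chain_gmodule G n) g c)"
proof -
  have fin: "finite {x. c x \<noteq> 0}" using c by auto
  have "lin_ext (\<lambda>x. indicat_real {left_mult G g x}) (cone_ext G h c) =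
      lin_ext (\<lambda>x. indicat_real {left_mult G g (cone G h x)}) c"
    using fin by (subst lin_ext_lin_ext) auto
  also have "\<dots> = lin_ext (\<lambda>x. indicat_real {cone G (cmp G g h) (left_mult G g x)}) c"
    using c by (intro lin_ext_cong) (auto simp: left_mult_cone[OF g h])
  also have "\<dots> = cone_ext G (cmp G g h) (lin_ext (\<lambda>x. indicat_real {left_mult G g x}) c)"
    using fin by (subst lin_ext_lin_ext) auto
  finally show ?thesis by simp
qed

end

section \<open>Averaging cochains over a mean\<close>

lemma linf_space_simps [simp]:
  "carrier (linf_space S) = {\<phi> \<in> extensional S. bounded (\<phi> ` S)}"
  "\<zero>\<^bsub>linf_space S\<^esub> = (\<lambda>x\<in>S. 0)"
  "\<phi> \<oplus>\<^bsub>linf_space S\<^esub> \<psi> = (\<lambda>x\<in>S. \<phi> x + \<psi> x)"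
  "r \<odot>\<^bsub>linf_space S\<^esub> \<phi> = (\<lambda>x\<in>S. r * \<phi> x)"
  "nrm (linf_space S) \<phi> = sup0 ((\<lambda>x. \<bar>\<phi> x\<bar>) ` S)"
  by (simp_all add: linf_space_def)

lemma linf_gmodule_simps [simp]:
  "sp (linf_gmodule G) e = linf_space (fibre G e)"
  "act (linf_gmodule G) g \<phi> = (\<lambda>h\<in>fibre G (tgt G g). \<phi> (cmp G (ginv G g) h))"
  by (simp_all add: linf_gmodule_def)

lemma bounded_image_real_iff: "bounded (\<phi> ` S) \<longleftrightarrow> (\<exists>K. \<forall>x\<in>S. \<bar>\<phi> x :: real\<bar> \<le> K)"
  by (simp add: bounded_iff)

lemma bdd_above_abs:
  fixes \<phi> :: "'a \<Rightarrow> real"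
  shows "bounded (\<phi> ` S) \<Longrightarrow> bdd_above ((\<lambda>x. \<bar>\<phi> x\<bar>) ` S)"
  by (auto simp: bounded_image_real_iff bdd_above_def)

lemma abs_le_linf_nrm:
  "\<lbrakk>\<phi> \<in> carrier (linf_space S); x \<in> S\<rbrakk> \<Longrightarrow> \<bar>\<phi> x\<bar> \<le> nrm (linf_space S) \<phi>"
  using bdd_above_abs[of \<phi> S] by (auto intro!: le_sup0)

lemma linf_nrm_le:
  "\<lbrakk>\<And>x. x \<in> S \<Longrightarrow> \<bar>\<phi> x\<bar> \<le> K; 0 \<le> K\<rbrakk> \<Longrightarrow> nrm (linf_space S) \<phi> \<le> K"
  by (auto intro!: sup0_le)

lemma linf_nrm_nonneg: "\<phi> \<in> carrier (linf_space S) \<Longrightarrow> 0 \<le> nrm (linf_space S) \<phi>"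
  by (auto intro!: sup0_nonneg bdd_above_abs)

lemma linf_space_memI:
  "(\<And>x. x \<in> S \<Longrightarrow> \<bar>\<phi> x\<bar> \<le> K) \<Longrightarrow> restrict \<phi> S \<in> carrier (linf_space S)"
  by (auto simp: bounded_image_real_iff)

lemma normed_space_on_linf_space: "normed_space_on (linf_space S)"
proof -
  let ?L = "linf_space S"
  have smult: "(\<lambda>x\<in>S. r * \<phi> x) \<in> carrier ?L" and
    smult_le: "nrm ?L (\<lambda>x\<in>S. r * \<phi> x) \<le> \<bar>r\<bar> * nrm ?L \<phi>" if "\<phi> \<in> carrier ?L" for r \<phi>
  proof -
    have "\<bar>r * \<phi> x\<bar> \<le> \<bar>r\<bar> * nrm ?L \<phi>" if "x \<in> S" for x
      using abs_le_linf_nrm[OF \<open>\<phi> \<in> carrier ?L\<close> that] by (auto simp: abs_mult intro: mult_left_mono)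
    then show "(\<lambda>x\<in>S. r * \<phi> x) \<in> carrier ?L" "nrm ?L (\<lambda>x\<in>S. r * \<phi> x) \<le> \<bar>r\<bar> * nrm ?L \<phi>"
      using linf_nrm_nonneg[OF that] by (auto intro!: linf_space_memI linf_nrm_le simp del: linf_space_simps)
  qed
  have add: "(\<lambda>x\<in>S. \<phi> x + \<psi> x) \<in> carrier ?L" and
    add_le: "nrm ?L (\<lambda>x\<in>S. \<phi> x + \<psi> x) \<le> nrm ?L \<phi> + nrm ?L \<psi>"
    if "\<phi> \<in> carrier ?L" "\<psi> \<in> carrier ?L" for \<phi> \<psi>
  proof -
    have "\<bar>\<phi> x + \<psi> x\<bar> \<le> nrm ?L \<phi> + nrm ?L \<psi>" if "x \<in> S" for x
      using abs_le_linf_nrm[OF \<open>\<phi> \<in> carrier ?L\<close> that] abs_le_linf_nrm[OF \<open>\<psi> \<in> carrier ?L\<close> that] by linarith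
    then show "(\<lambda>x\<in>S. \<phi> x + \<psi> x) \<in> carrier ?L" "nrm ?L (\<lambda>x\<in>S. \<phi> x + \<psi> x) \<le> nrm ?L \<phi> + nrm ?L \<psi>"
      using linf_nrm_nonneg[OF that(1)] linf_nrm_nonneg[OF that(2)]
      by (auto intro!: linf_space_memI linf_nrm_le simp del: linf_space_simps)
  qed
  have zero: "(\<lambda>x\<in>S. 0) \<in> carrier ?L" by (rule linf_space_memI[of _ _ 0]) simp
  have nrm_zero: "nrm ?L (\<lambda>x\<in>S. 0) = 0"
    by (rule antisym[OF linf_nrm_le linf_nrm_nonneg[OF zero]]) auto
  have eqI: "\<phi> = \<psi>" if "\<phi> \<in> carrier ?L" "\<psi> \<in> carrier ?L" "\<And>x. x \<in> S \<Longrightarrow> \<phi> x = \<psi> x" for \<phi> \<psi>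
    using that by (auto intro: extensionalityI)
  show ?thesis
    unfolding linf_space_def
  proof (intro normed_space_on_mk_nspaceI abelian_group_mk_nspaceI,
      unfold linf_space_simps(1,5)[symmetric])
    fix \<phi> assume \<phi>: "\<phi> \<in> carrier ?L"
    show "\<phi> = (\<lambda>x\<in>S. 0)" if "nrm ?L \<phi> = 0"
      using abs_le_linf_nrm[OF \<phi>] that by (intro eqI[OF \<phi> zero]) auto
    show "nrm ?L (\<lambda>x\<in>S. r * \<phi> x) = \<bar>r\<bar> * nrm ?L \<phi>" for r
    proof (cases "r = 0")
      case True
      then show ?thesis using nrm_zero by (simp del: linf_space_simps)
    next
      case False
      let ?g = "\<lambda>x\<in>S. r * \<phi> x"
      \<comment> \<open>Scaling back by \<open>inverse r\<close> turns the one-sided estimate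
        \<open>smult_le\<close> into the reverse one.\<close>
      have "(\<lambda>x\<in>S. inverse r * ?g x) = \<phi>"
        using False by (intro eqI smult \<phi>) auto
      then have "nrm ?L \<phi> \<le> \<bar>inverse r\<bar> * nrm ?L ?g"
        using smult_le[OF smult[OF \<phi>, of r], of "inverse r"] by metis
      then have "\<bar>r\<bar> * nrm ?L \<phi> \<le> nrm ?L ?g"
        using False by (simp add: field_simps del: linf_space_simps)
      then show ?thesis using smult_le[OF \<phi>, of r] by (simp del: linf_space_simps)
    qed
    show "(\<lambda>x\<in>S. (\<lambda>x\<in>S. 0) x + \<phi> x) = \<phi>" "(\<lambda>x\<in>S. 1 * \<phi> x) = \<phi>"
      using add[OF zero \<phi>] smult[OF \<phi>, of 1] by (intro eqI \<phi>; simp del: linf_space_simps)+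
  qed (((rule zero nrm_zero add add_le smult linf_nrm_nonneg; assumption) |
      (rule restrict_ext, simp add: algebra_simps))+)
qed

lemma dual_gmodule_simps [simp]:
  "sp (dual_gmodule G V) e = op_space (sp V e) real_space"
  "act (dual_gmodule G V) g f = (\<lambda>v\<in>carrier (sp V (tgt G g)). f (act V (ginv G g) v))"
  by (simp_all add: dual_gmodule_def)

text \<open>The inner restriction produces an extensional function on the fibre, as
  \<open>linf_space\<close> demands, and the one over \<open>v\<close> an extensional functional, as
  \<open>op_space\<close> demands. The arguments \<open>e\<close> and \<open>c\<close> stay
  unrestricted until a cochain is formed.\<close>

definition average :: "('o, 'g) groupoid \<Rightarrow> ('o, 'g, 'v) gmodule \<Rightarrow> ('o \<Rightarrow> ('g \<Rightarrow> real) \<Rightarrow> real) \<Rightarrow>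
    ('o \<Rightarrow> ('g list \<Rightarrow> real) \<Rightarrow> 'v \<Rightarrow> real) \<Rightarrow> 'o \<Rightarrow> ('g list \<Rightarrow> real) \<Rightarrow> 'v \<Rightarrow> real" where
  "average G V m f = (\<lambda>e c. \<lambda>v\<in>carrier (sp V e). m e (\<lambda>h\<in>fibre G e. f e (cone_ext G h c) v))"

lemma normed_gmodule_dual_gmodule:
  assumes "normed_gmodule G V" shows "normed_gmodule G (dual_gmodule G V)"
  unfolding dual_gmodule_def
  by (intro normed_gmodule_hom_gmodule normed_gmodule_triv_gmodule assms
      normed_gmodule.axioms(1)[OF assms])

text \<open>With \<open>K\<close> bounding \<open>f\<close> and \<open>M\<close> bounding
  \<open>m\<close>, the average is bounded by \<open>M * K\<close>, because coning does not increase
  the norm. Linearity in \<open>v\<close> and in \<open>c\<close> passes through \<open>m\<close>;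
  equivariance is a change of variable in the fibre.\<close>

lemma gmap_average:
  assumes V: "normed_gmodule G V"
    and m: "gmap G (linf_gmodule G) triv_gmodule m"
    and f: "gmap G (chain_gmodule G (Suc n)) (dual_gmodule G V) f"
  shows "gmap G (chain_gmodule G n) (dual_gmodule G V) (average G V m f)"
proof -
  interpret V: normed_gmodule G V by fact
  note chain = V.normed_gmodule_chain_gmodule
  note dual = normed_gmodule_dual_gmodule[OF V]
  note fI = f[unfolded gmap_iff[OF chain dual]]
  have "normed_space_on (sp (linf_gmodule G) e)" "normed_space_on (sp triv_gmodule e)" for e
    by (simp_all add: normed_space_on_linf_space normed_space_on_real_space)
  note mI = m[unfolded gmap_iff_normed[OF this]]
  let ?C = "\<lambda>n e. l1_free_space (paths G n e)" and ?L = "\<lambda>e. linf_space (fibre G e)"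
  let ?V' = "\<lambda>e. op_space (sp V e) real_space"
  let ?\<phi> = "\<lambda>e c v. \<lambda>h\<in>fibre G e. f e (cone_ext G h c) v"
  obtain K where K: "0 \<le> K" "\<And>e c. \<lbrakk>e \<in> ob G; c \<in> carrier (?C (Suc n) e)\<rbrakk> \<Longrightarrow>
      nrm (?V' e) (f e c) \<le> K * nrm (?C (Suc n) e) c"
    using conjunct2[OF conjunct2[OF fI]] unfolding chain_gmodule_simps dual_gmodule_simps by metis
  obtain M where M: "0 \<le> M" "\<And>e \<phi>. \<lbrakk>e \<in> ob G; \<phi> \<in> carrier (?L e)\<rbrakk> \<Longrightarrow>
      \<bar>m e \<phi>\<bar> \<le> M * nrm (?L e) \<phi>"
    using conjunct2[OF conjunct2[OF mI]]
    unfolding linf_gmodule_simps triv_gmodule_simps real_space_simps by metis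
  have f_lin: "linear_on (?C (Suc n) e) (?V' e) (f e)" if "e \<in> ob G" for e
    using fI that by (simp del: l1_free_space_simps op_space_simps)
  have m_lin: "linear_on (?L e) real_space (m e)" if "e \<in> ob G" for e
    using mI that by (simp del: linf_space_simps)
  have f_in: "bounded_linear_on (sp V e) real_space (f e (cone_ext G h c))"
    if "e \<in> ob G" "h \<in> fibre G e" "c \<in> carrier (?C n e)" for e h c
    using linear_onD(1)[OF f_lin[OF that(1)] linear_onD(1)[OF V.linear_on_cone_ext[OF that(2)] that(3)]]
    by simp
  note f_in_lin = linear_onD[OF bounded_linear_onD(1)[OF f_in]]
  have bound: "\<bar>f e (cone_ext G h c) v\<bar> \<le> K * nrm (?C n e) c * nrm (sp V e) v"
    if e: "e \<in> ob G" and h: "h \<in> fibre G e" and c: "c \<in> carrier (?C n e)" and v: "v \<in> carrier (sp V e)"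
    for e h c v
  proof -
    note c' = linear_onD(1)[OF V.linear_on_cone_ext[OF h] c]
    have "nrm (?V' e) (f e (cone_ext G h c)) \<le> K * nrm (?C n e) c"
      by (rule order_trans[OF K(2)[OF e c'] mult_left_mono[OF V.nrm_cone_ext_le[OF h c] K(1)]])
    then have "op_nrm (sp V e) real_space (f e (cone_ext G h c)) * nrm (sp V e) v \<le>
        K * nrm (?C n e) c * nrm (sp V e) v"
      using normed_space_on.nrm_nonneg[OF V.normed[OF e] v]
      by (intro mult_right_mono) (simp_all del: l1_free_space_simps)
    then show ?thesis
      using nrm_le_op_nrm[OF V.normed[OF e] normed_space_on_real_space f_in[OF e h c] v]
      by (simp del: l1_free_space_simps)
  qed
  \<comment> \<open>A bound for a supremum norm must be nonnegative here, since \<open>sup0\<close>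
    includes the value 0.\<close>
  have bound_nonneg: "0 \<le> K * nrm (?C n e) c * nrm (sp V e) v"
    if "e \<in> ob G" "c \<in> carrier (?C n e)" "v \<in> carrier (sp V e)" for e c v
    using K(1) normed_space_on.nrm_nonneg[OF V.normed[OF that(1)] that(3)]
      normed_space_on.nrm_nonneg[OF normed_space_on_l1_free_space that(2)]
    by (simp del: l1_free_space_simps)
  have \<phi>_in: "?\<phi> e c v \<in> carrier (?L e)"
    and m_le: "\<bar>m e (?\<phi> e c v)\<bar> \<le> M * K * nrm (?C n e) c * nrm (sp V e) v"
    if e: "e \<in> ob G" and c: "c \<in> carrier (?C n e)" and v: "v \<in> carrier (sp V e)" for e c v
  proof -
    show \<phi>: "?\<phi> e c v \<in> carrier (?L e)"
      by (rule linf_space_memI) (rule bound[OF e _ c v])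
    have "nrm (?L e) (?\<phi> e c v) \<le> K * nrm (?C n e) c * nrm (sp V e) v"
      using bound[OF e _ c v] bound_nonneg[OF that]
      by (intro linf_nrm_le) (simp_all del: l1_free_space_simps)
    then have "M * nrm (?L e) (?\<phi> e c v) \<le> M * (K * nrm (?C n e) c * nrm (sp V e) v)"
      using M(1) by (rule mult_left_mono)
    then show "\<bar>m e (?\<phi> e c v)\<bar> \<le> M * K * nrm (?C n e) c * nrm (sp V e) v"
      using M(2)[OF e \<phi>] by (simp add: mult.assoc del: l1_free_space_simps linf_space_simps)
  qed
  have lin_V: "linear_on (sp V e) real_space (average G V m f e c)"
    if e: "e \<in> ob G" and c: "c \<in> carrier (?C n e)" for e c
  proof (rule linear_onI)
    interpret Ve: normed_space_on "sp V e" by (rule V.normed[OF e])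
    fix v assume v: "v \<in> carrier (sp V e)"
    show "average G V m f e c (r \<odot>\<^bsub>sp V e\<^esub> v) = r \<odot>\<^bsub>real_space\<^esub> average G V m f e c v" for r
    proof -
      have "?\<phi> e c (r \<odot>\<^bsub>sp V e\<^esub> v) = r \<odot>\<^bsub>?L e\<^esub> ?\<phi> e c v"
        using f_in_lin(3)[OF e _ c v] by (auto intro!: restrict_ext)
      then show ?thesis
        using linear_onD(3)[OF m_lin[OF e] \<phi>_in[OF e c v], of r] v
        by (simp add: average_def Ve.smult_in del: linf_space_simps)
    qed
    fix w assume w: "w \<in> carrier (sp V e)"
    have "?\<phi> e c (v \<oplus>\<^bsub>sp V e\<^esub> w) = ?\<phi> e c v \<oplus>\<^bsub>?L e\<^esub> ?\<phi> e c w"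
      using f_in_lin(2)[OF e _ c v w] by (auto intro!: restrict_ext)
    then show "average G V m f e c (v \<oplus>\<^bsub>sp V e\<^esub> w) =
        average G V m f e c v \<oplus>\<^bsub>real_space\<^esub> average G V m f e c w"
      using linear_onD(2)[OF m_lin[OF e] \<phi>_in[OF e c v] \<phi>_in[OF e c w]] v w
      by (simp add: average_def del: linf_space_simps)
  qed simp
  have in_V': "average G V m f e c \<in> carrier (?V' e)"
    if e: "e \<in> ob G" and c: "c \<in> carrier (?C n e)" for e c
  proof -
    have "\<forall>v\<in>carrier (sp V e). nrm real_space (average G V m f e c v) \<le>
        M * K * nrm (?C n e) c * nrm (sp V e) v"
      using m_le[OF e c] by (simp add: average_def del: l1_free_space_simps)
    moreover have "average G V m f e c \<in> extensional (carrier (sp V e))"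
      by (simp add: average_def)
    ultimately show ?thesis
      using lin_V[OF e c] unfolding op_space_simps bounded_linear_on_def by blast
  qed
  show ?thesis
    unfolding gmap_iff[OF chain dual] chain_gmodule_simps(1) dual_gmodule_simps(1)
  proof (intro conjI ballI exI[of _ "M * K"])
    show "0 \<le> M * K" using M(1) K(1) by simp
    fix e assume e: "e \<in> ob G"
    show "linear_on (?C n e) (?V' e) (average G V m f e)"
    proof (rule linear_onI)
      fix c assume c: "c \<in> carrier (?C n e)"
      show "average G V m f e c \<in> carrier (?V' e)" by (rule in_V'[OF e c])
      show "average G V m f e (r \<odot>\<^bsub>?C n e\<^esub> c) = r \<odot>\<^bsub>?V' e\<^esub> average G V m f e c" for r
      proof -
        have "?\<phi> e (r \<odot>\<^bsub>?C n e\<^esub> c) v = r \<odot>\<^bsub>?L e\<^esub> ?\<phi> e c v" if v: "v \<in> carrier (sp V e)" for v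
        proof -
          have "f e (cone_ext G h (r \<odot>\<^bsub>?C n e\<^esub> c)) = r \<odot>\<^bsub>?V' e\<^esub> f e (cone_ext G h c)"
            if h: "h \<in> fibre G e" for h
            using linear_onD[OF V.linear_on_cone_ext[OF h]] linear_onD(3)[OF f_lin[OF e]] c
            by (simp del: l1_free_space_simps op_space_simps)
          then show ?thesis using v by (auto simp del: l1_free_space_simps intro!: restrict_ext)
        qed
        then show ?thesis
          using linear_onD(3)[OF m_lin[OF e] \<phi>_in[OF e c], of _ r]
          by (simp add: average_def del: linf_space_simps l1_free_space_simps cong: restrict_cong)
      qed
      fix d assume d: "d \<in> carrier (?C n e)"
      have "?\<phi> e (c \<oplus>\<^bsub>?C n e\<^esub> d) v = ?\<phi> e c v \<oplus>\<^bsub>?L e\<^esub> ?\<phi> e d v" if v: "v \<in> carrier (sp V e)" for v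
      proof -
        have "f e (cone_ext G h (c \<oplus>\<^bsub>?C n e\<^esub> d)) =
            f e (cone_ext G h c) \<oplus>\<^bsub>?V' e\<^esub> f e (cone_ext G h d)"
          if h: "h \<in> fibre G e" for h
          using linear_onD[OF V.linear_on_cone_ext[OF h]] linear_onD(2)[OF f_lin[OF e]] c d
          by (simp del: l1_free_space_simps op_space_simps)
        then show ?thesis using v by (auto simp del: l1_free_space_simps intro!: restrict_ext)
      qed
      then show "average G V m f e (c \<oplus>\<^bsub>?C n e\<^esub> d) =
          average G V m f e c \<oplus>\<^bsub>?V' e\<^esub> average G V m f e d"
        using linear_onD(2)[OF m_lin[OF e] \<phi>_in[OF e c] \<phi>_in[OF e d]]
        by (simp add: average_def del: linf_space_simps l1_free_space_simps cong: restrict_cong)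
    qed
    fix c assume c: "c \<in> carrier (?C n e)"
    show "nrm (?V' e) (average G V m f e c) \<le> M * K * nrm (?C n e) c"
      unfolding op_space_simps
    proof (rule op_nrm_le[OF V.normed[OF e]])
      show "0 \<le> M * K * nrm (?C n e) c"
        using M(1) K(1) normed_space_on.nrm_nonneg[OF normed_space_on_l1_free_space c] by simp
    qed (use m_le[OF e c] in \<open>simp add: average_def del: l1_free_space_simps\<close>)
  next
    fix g c assume g: "g \<in> mor G" and c: "c \<in> carrier (?C n (src G g))"
    note ob = V.src_ob[OF g] V.tgt_ob[OF g]
    let ?gc = "act (chain_gmodule G n) g c"
    show "average G V m f (tgt G g) ?gc = act (dual_gmodule G V) g (average G V m f (src G g) c)"
    proof -
      have "m (tgt G g) (?\<phi> (tgt G g) ?gc v) = m (src G g) (?\<phi> (src G g) c (act V (ginv G g) v))"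
        if v: "v \<in> carrier (sp V (tgt G g))" for v
      proof -
        let ?w = "act V (ginv G g) v"
        have w: "?w \<in> carrier (sp V (src G g))" by (rule V.act_ginv_closed[OF g v])
        have "?\<phi> (tgt G g) ?gc v = act (linf_gmodule G) g (?\<phi> (src G g) c ?w)"
        proof -
          have "f (tgt G g) (cone_ext G h ?gc) v = f (src G g) (cone_ext G (cmp G (ginv G g) h) c) ?w"
            if h: "h \<in> fibre G (tgt G g)" for h
          proof -
            \<comment> \<open>The change of variable: each \<open>h\<close> over the target of
              \<open>g\<close> is \<open>g\<close> composed with \<open>?k\<close> over its source.
              The cone with apex \<open>h\<close> on the translated chain is thus the translate of
              the cone with apex \<open>?k\<close>, to which equivariance of \<open>f\<close>
              applies.\<close>
            let ?k = "cmp G (ginv G g) h"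
            have k: "?k \<in> fibre G (src G g)" and gk: "cmp G g ?k = h"
              using h g by (auto simp: fibre_def V.mor_simps V.cmp_ginv_cancel_left)
            have "cone_ext G h ?gc = act (chain_gmodule G (Suc n)) g (cone_ext G ?k c)"
              unfolding V.act_cone_ext[OF g k c] gk ..
            moreover have "f (tgt G g) (act (chain_gmodule G (Suc n)) g (cone_ext G ?k c)) =
                act (dual_gmodule G V) g (f (src G g) (cone_ext G ?k c))"
              using fI g linear_onD(1)[OF V.linear_on_cone_ext[OF k] c]
              by (simp del: l1_free_space_simps dual_gmodule_simps(2) chain_gmodule_simps(2))
            ultimately show ?thesis using v by simp
          qed
          then show ?thesis
            using g by (auto simp: fibre_def V.mor_simps intro!: restrict_ext)
        qed
        then show ?thesis
          using mI g \<phi>_in[OF ob(1) c w]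
          by (simp del: l1_free_space_simps linf_gmodule_simps(2) linf_space_simps)
      qed
      then show ?thesis
        using V.act_ginv_closed[OF g] by (auto simp: average_def intro!: restrict_ext simp del: chain_gmodule_simps(2))
    qed
  qed
qed

section \<open>Vanishing of bounded cohomology\<close>

lemma carrier_cochains:
  assumes "normed_gmodule G W"
  shows "f \<in> carrier (cochains G W n) \<longleftrightarrow>
    f \<in> extensional (ob G) \<and> (\<forall>e\<in>ob G. f e \<in> extensional (carrier (l1_free_space (paths G n e)))) \<and>
    gmap G (chain_gmodule G n) W f"
  using carrier_BG[OF groupoid.normed_gmodule_chain_gmodule assms] normed_gmodule.axioms(1)[OF assms]
  by (simp add: cochains_def del: l1_free_space_simps)

lemma group_cochains:
  assumes "normed_gmodule G W"
  shows "group (add_monoid (cochains G W n))"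
  unfolding cochains_def BG_def
  by (intro abelian_group.a_group abelian_group_invariants normed_gmodule_hom_gmodule
      groupoid.normed_gmodule_chain_gmodule assms normed_gmodule.axioms(1)[OF assms])

lemma cochains_simps [simp]:
  "\<zero>\<^bsub>cochains G W n\<^esub> = (\<lambda>e\<in>ob G. \<lambda>c\<in>carrier (l1_free_space (paths G n e)). \<zero>\<^bsub>sp W e\<^esub>)"
  "f \<oplus>\<^bsub>cochains G W n\<^esub> f' =
    (\<lambda>e\<in>ob G. \<lambda>c\<in>carrier (l1_free_space (paths G n e)). f e c \<oplus>\<^bsub>sp W e\<^esub> f' e c)"
  by (simp_all add: cochains_def BG_def del: l1_free_space_simps)

lemma restrict_in_cochains:
  assumes "normed_gmodule G W" "gmap G (chain_gmodule G n) W f"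
  shows "(\<lambda>e\<in>ob G. \<lambda>c\<in>carrier (l1_free_space (paths G n e)). f e c) \<in> carrier (cochains G W n)"
  using gmap_restrict[OF groupoid.normed_gmodule_chain_gmodule assms] normed_gmodule.axioms(1)[OF assms(1)]
  by (simp add: carrier_cochains[OF assms(1)] del: l1_free_space_simps)

lemma coboundary_in_cochains:
  assumes "normed_gmodule G W" "f \<in> carrier (cochains G W n)"
  shows "coboundary G n f \<in> carrier (cochains G W (Suc n))"
proof -
  interpret W: normed_gmodule G W by fact
  have "gmap G (chain_gmodule G n) W f" using assms by (simp add: carrier_cochains)
  then have "gmap G (chain_gmodule G (Suc n)) W (\<lambda>e c. f e (boundary G (Suc n) c))"
    by (rule gmap_comp[OF W.normed_gmodule_chain_gmodule W.normed_gmodule_chain_gmodule assms(1)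
          W.gmap_boundary])
  then show ?thesis
    using restrict_in_cochains[OF assms(1)] by (simp add: coboundary_def del: l1_free_space_simps)
qed

text \<open>As the kernel of a homomorphism, the cocycles form a subgroup; this is needed to
  identify the group generated by them.\<close>

lemma group_hom_coboundary:
  assumes "normed_gmodule G W"
  shows "group_hom (add_monoid (cochains G W n)) (add_monoid (cochains G W (Suc n))) (coboundary G n)"
proof -
  interpret W: normed_gmodule G W by fact
  have "coboundary G n (f \<oplus>\<^bsub>cochains G W n\<^esub> f') =
      coboundary G n f \<oplus>\<^bsub>cochains G W (Suc n)\<^esub> coboundary G n f'" for f f'
    using W.boundary_closed
    by (auto simp: coboundary_def simp del: l1_free_space_simps intro!: restrict_ext)
  then have "coboundary G n \<in> hom (add_monoid (cochains G W n)) (add_monoid (cochains G W (Suc n)))"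
    using coboundary_in_cochains[OF assms] by (intro homI) (simp_all del: cochains_simps)
  then show ?thesis
    by (intro group_hom.intro group_hom_axioms.intro group_cochains assms)
qed

lemma restrict_eq_iff: "restrict f A = restrict g A \<longleftrightarrow> (\<forall>x\<in>A. f x = g x)"
  by (metis restrict_apply' restrict_ext)

text \<open>The coboundary and the zero cochain are restricted to the same objects and carriers, so
  their equality as functions is the pointwise condition.\<close>

lemma mem_cocycles_iff:
  "f \<in> cocycles G W n \<longleftrightarrow> f \<in> carrier (cochains G W n) \<and>
    (\<forall>e\<in>ob G. \<forall>c\<in>carrier (l1_free_space (paths G (Suc n) e)). f e (boundary G (Suc n) c) = \<zero>\<^bsub>sp W e\<^esub>)"
proof -
  have "coboundary G n f = \<zero>\<^bsub>cochains G W (Suc n)\<^esub> \<longleftrightarrow>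
    (\<forall>e\<in>ob G. \<forall>c\<in>carrier (l1_free_space (paths G (Suc n) e)). f e (boundary G (Suc n) c) = \<zero>\<^bsub>sp W e\<^esub>)"
    unfolding coboundary_def cochains_simps chain_gmodule_simps
    by (simp add: restrict_eq_iff del: l1_free_space_simps)
  then show ?thesis by (simp add: cocycles_def kernel_def del: l1_free_space_simps cochains_simps)
qed

lemma coboundary_in_cocycles:
  assumes W: "normed_gmodule G W" and f: "f \<in> carrier (cochains G W n)"
  shows "coboundary G n f \<in> cocycles G W (Suc n)"
proof -
  interpret W: normed_gmodule G W by fact
  have f': "linear_on (l1_free_space (paths G n e)) (sp W e) (f e)" if "e \<in> ob G" for e
    using f that unfolding carrier_cochains[OF W] gmap_iff[OF W.normed_gmodule_chain_gmodule W]
    by (simp del: l1_free_space_simps)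
  have "coboundary G n f e (boundary G (Suc (Suc n)) c) = \<zero>\<^bsub>sp W e\<^esub>"
    if e: "e \<in> ob G" and c: "c \<in> carrier (l1_free_space (paths G (Suc (Suc n)) e))" for e c
    using linear_on_zero[OF normed_space_on_l1_free_space W.normed[OF e] f'[OF e]] e
      W.boundary_closed[OF c] W.boundary_boundary[OF c]
    by (simp add: coboundary_def del: l1_free_space_simps(1))
  then show ?thesis
    using coboundary_in_cochains[OF W f] by (simp add: mem_cocycles_iff del: l1_free_space_simps)
qed

lemma cocycle_is_coboundary:
  assumes V: "normed_gmodule G V" and m: "gmap G (linf_gmodule G) triv_gmodule m"
    and const: "\<And>e a. e \<in> ob G \<Longrightarrow> m e (\<lambda>h\<in>fibre G e. a) = a"
    and f: "f \<in> cocycles G (dual_gmodule G V) (Suc n)"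
  shows "f \<in> coboundary G n ` carrier (cochains G (dual_gmodule G V) n)"
proof
  interpret V: normed_gmodule G V by fact
  note dual = normed_gmodule_dual_gmodule[OF V]
  let ?C = "\<lambda>n e. l1_free_space (paths G n e)"
  have fc: "f \<in> carrier (cochains G (dual_gmodule G V) (Suc n))"
    and cocycle: "\<And>e c. \<lbrakk>e \<in> ob G; c \<in> carrier (?C (Suc (Suc n)) e)\<rbrakk> \<Longrightarrow>
      f e (boundary G (Suc (Suc n)) c) = (\<lambda>v\<in>carrier (sp V e). 0)"
    using f by (simp_all add: mem_cocycles_iff del: l1_free_space_simps)
  then have f_ext: "f \<in> extensional (ob G)" "\<And>e. e \<in> ob G \<Longrightarrow> f e \<in> extensional (carrier (?C (Suc n) e))"
    and f_gmap: "gmap G (chain_gmodule G (Suc n)) (dual_gmodule G V) f"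
    by (simp_all add: carrier_cochains[OF dual] del: l1_free_space_simps)
  have f_lin: "linear_on (?C (Suc n) e) (op_space (sp V e) real_space) (f e)" if "e \<in> ob G" for e
    using f_gmap that unfolding gmap_iff[OF V.normed_gmodule_chain_gmodule dual]
    by (simp del: l1_free_space_simps op_space_simps)
  let ?b = "\<lambda>e\<in>ob G. \<lambda>c\<in>carrier (?C n e). average G V m f e c"
  show "?b \<in> carrier (cochains G (dual_gmodule G V) n)"
    by (intro restrict_in_cochains dual gmap_average V m f_gmap)
  have "average G V m f e (boundary G (Suc n) c) = f e c"
    if e: "e \<in> ob G" and c: "c \<in> carrier (?C (Suc n) e)" for e c
  proof -
    have fec: "f e c \<in> extensional (carrier (sp V e))"
      using linear_onD(1)[OF f_lin[OF e] c] by simp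
    have "f e (cone_ext G h (boundary G (Suc n) c)) v = f e c v"
      if h: "h \<in> fibre G e" and v: "v \<in> carrier (sp V e)" for h v
    proof -
      let ?x = "boundary G (Suc (Suc n)) (cone_ext G h c)" and ?y = "cone_ext G h (boundary G (Suc n) c)"
      have hc: "cone_ext G h c \<in> carrier (?C (Suc (Suc n)) e)"
        by (rule linear_onD(1)[OF V.linear_on_cone_ext[OF h] c])
      have x: "?x \<in> carrier (?C (Suc n) e)" by (rule V.boundary_closed[OF hc])
      have y: "?y \<in> carrier (?C (Suc n) e)"
        by (rule linear_onD(1)[OF V.linear_on_cone_ext[OF h] V.boundary_closed[OF c]])
      \<comment> \<open>The homotopy identity is used in the positive degree \<open>Suc n\<close>,
        where the boundary of \<open>c\<close> is a chain of degree \<open>n\<close> on which the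
        averaged cochain is defined.\<close>
      have "?x \<oplus>\<^bsub>?C (Suc n) e\<^esub> ?y = c"
        using V.boundary_cone_ext[OF h c] by (simp add: fun_eq_iff)
      then have "f e c = f e ?x \<oplus>\<^bsub>op_space (sp V e) real_space\<^esub> f e ?y"
        using linear_onD(2)[OF f_lin[OF e] x y] by simp
      then show ?thesis using cocycle[OF e hc] v by simp
    qed
    then have "(\<lambda>h\<in>fibre G e. f e (cone_ext G h (boundary G (Suc n) c)) v) = (\<lambda>h\<in>fibre G e. f e c v)"
      if "v \<in> carrier (sp V e)" for v
      using that by (intro restrict_ext) auto
    then show ?thesis
      using fec by (auto simp: average_def const[OF e] intro!: extensionalityI[of _ "carrier (sp V e)"])
  qed
  \<comment> \<open>The values agree on objects and chains; elsewhere both sides are extensional, in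
    the object as well as in the chain.\<close>
  then show "f = coboundary G n ?b"
    using V.boundary_closed f_ext
    by (auto simp: coboundary_def simp del: l1_free_space_simps
        intro!: extensionalityI[of _ "ob G"] extensionalityI[of _ "carrier (?C _ _)"])
qed

text \<open>A group has only one coset of itself. Once cocycles and coboundaries coincide,
  cohomology is a quotient of this kind.\<close>

lemma (in group) trivial_group_Mod_carrier: "trivial_group (G Mod carrier G)"
proof -
  have "group (G Mod carrier G)"
    using normal.factorgroup_is_group normal_self by blast
  moreover have "carrier (G Mod carrier G) = {\<one>\<^bsub>G Mod carrier G\<^esub>}"
    using coset_join2[OF _ subgroup_self] by (auto simp: FactGroup_def RCOSETS_def)
  ultimately show ?thesis by (simp add: trivial_group_def)
qed

theorem corollary6p4:
  fixes G :: "('o, 'g) groupoid" and V :: "('o, 'g, 'v) gmodule" and n :: nat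
  assumes "groupoid G" and "amenable G" and "banach_gmodule G V" and "n \<ge> 1"
  shows "trivial_group (bounded_cohomology G (dual_gmodule G V) n)"
proof -
  obtain k where n: "n = Suc k" using \<open>n \<ge> 1\<close> by (cases n) auto
  have V: "normed_gmodule G V" using assms(3) by (rule banach_gmodule.axioms(1))
  note dual = normed_gmodule_dual_gmodule[OF V]
  let ?A = "add_monoid (cochains G (dual_gmodule G V) n)"
  let ?Z = "cocycles G (dual_gmodule G V) n"
  obtain m where m: "gmap G (linf_gmodule G) triv_gmodule m"
    "\<And>e a. e \<in> ob G \<Longrightarrow> m e (\<lambda>h\<in>fibre G e. a) = a"
    using assms(2) by (auto simp: amenable_def)
  interpret A: group ?A by (rule group_cochains[OF dual])
  have "subgroup ?Z ?A"
    unfolding cocycles_def by (rule group_hom.subgroup_kernel[OF group_hom_coboundary[OF dual]])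
  \<comment> \<open>The cocycles are already a subgroup, so generating adds nothing to them.\<close>
  then have "carrier (subgroup_generated ?A ?Z) = ?Z"
    by (rule subgroup.carrier_subgroup_generated_subgroup)
  \<comment> \<open>Writing \<open>n\<close> as \<open>Suc k\<close> selects the clause of
    \<open>coboundaries\<close> that is an image from degree \<open>k\<close>. One inclusion is the
    vanishing of the squared boundary, the other is the averaging argument.\<close>
  moreover have "coboundaries G (dual_gmodule G V) n = ?Z"
    using coboundary_in_cocycles[OF dual] cocycle_is_coboundary[OF V m] by (auto simp: n)
  ultimately show ?thesis
    unfolding bounded_cohomology_def
    using group.trivial_group_Mod_carrier[OF A.group_subgroup_generated, of ?Z] by simp
qed

end
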